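(* For each $n$, let $p_n$ be a probability distribution on the positive integers and let $X_n$ be a random variable with distribution $p_n$. Assume that $\mu_n=E(\log X_n)>0$ (including possibly $\mu_n=\infty$). Assume further that there exists a sequence $(a_n)$ of positive reals tending to infinity and satisfying $$a_n=O(\log n),\qquad \lim_{n\to\infty}\frac{(\log n)\,E Z_n^2}{a_n^2\,EY_n}=0,\qquad \lim_{n\to\infty}\frac{\log n}{EY_n}=\infty,$$ where $Y_n=Z_n=\log X_n$ if $\log X_n\le a_n$, and $Y_n=0$, $Z_n=a_n$ if $\log X_n>a_n$. Then the family $\{(S_n,Q_{n,p_n},U_n)\}_{n\ge1}$ of $p_n$-shuffles presents a total variation cutoff with critical time $$t_n=\frac{3\log n}{2EY_n}.$$
   Context: Shuffles. $S_n$ is the set of arrangements of a deck of $n$ cards labelled $1,\dots,n$, identified with the symmetric group (an arrangement $\sigma$ lists cards $\sigma(1),\dots,\sigma(n)$ from top to bottom); $U_n$ is the uniform distribution on $S_n$. A rising sequence of $\sigma$ is a maximal set of cards with consecutive face values appearing in increasing order in $\sigma$; $r(\sigma)$ is the number of rising sequences, i.e. $1$ plus the number of $i\in\{1,\dots,n-1\}$ such that card $i+1$ appears before card $i$. For an integer $m\ge1$, an $m$-shuffle cuts the deck into $m$ packs of sizes $(a_1,\dots,a_m)$ with multinomial probability $m^{-n}\frac{n!}{a_1!\cdots a_m!}$, then drops cards one by one, from pack $i$ with probability proportional to its current size. Its distribution $Q_{n,m}$, started from a deck in order, is given by (Bayer–Diaconis) $Q_{n,m}(\sigma)=m^{-n}\binom{n+m-r(\sigma)}{n}$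 (the binomial being $0$ if $m<r(\sigma)$), and this may be taken as the definition. For a probability $p$ on $\{1,2,\dots\}$, the $p$-shuffle is $Q_{n,p}=\sum_{m\ge1}p(m)Q_{n,m}$. For a probability $Q$ on $S_n$, $Q^k$ is the distribution after $k$ independent successive $Q$-shuffles from a deck in order, i.e. the $k$-fold convolution power of $Q$ on the symmetric group ($Q^0$ is the point mass at the identity). It is known that $Q_{n,m}*Q_{n,m'}=Q_{n,mm'}$. $\|\mu-\nu\|_{\mathrm{TV}}=\sup_{A}\{\mu(A)-\nu(A)\}$. Convention: in the limit conditions, $x/0=\infty$ for $x>0$; since $\mu_n>0$ gives $EZ_n^2>0$ for $a_n>0$, the second condition includes that $EY_n>0$ for all sufficiently large $n$. Cutoff. For probabilities $Q_n$ on $S_n$, the family $\{(S_n,Q_n,U_n)\}$ presents a total variation cutoff with critical time $t_n$ (with $0<t_n<\infty$ for all sufficiently large $n$) if for every fixed $\epsilon\in(0,1)$: $\lim_{n\to\infty}\|Q_n^{k_n}-U_n\|_{\mathrm{TV}}=0$ for every sequence of non-negative integers with $k_n>(1+\epsilon)t_n$ for all large $n$, and $\lim_{n\to\infty}\|Q_n^{k_n}-U_n\|_{\mathrm{TV}}=1$ for every sequence of non-negative integers with $k_n<(1-\epsilon)t_n$ for all large $n$. (By group invariance the starting arrangement is irrelevant.) *)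

theory Defs
  imports
    "HOL-Probability.Probability"
    "HOL-Combinatorics.Permutations"
    "HOL-Library.Landau_Symbols"
begin

text \<open>
  An arrangement sends a position to the card in that position, so the position of card
  \<open>j\<close> is \<open>inv \<sigma> j\<close>. Probabilities on the finite set of arrangements are given by their
  mass functions, extended by zero.
\<close>

definition arrangements :: "nat \<Rightarrow> (nat \<Rightarrow> nat) set" where
  "arrangements n = {\<sigma>. \<sigma> permutes {1..n}}"

definition uniform_mass :: "nat \<Rightarrow> (nat \<Rightarrow> nat) \<Rightarrow> real" where
  "uniform_mass n \<sigma> = (if \<sigma> \<in> arrangements n then 1 / real (card (arrangements n)) else 0)"

definition rising_sequences :: "nat \<Rightarrow> (nat \<Rightarrow> nat) \<Rightarrow> nat" where
  "rising_sequences n \<sigma> = 1 + card {i \<in> {1..<n}. inv \<sigma> (i + 1) < inv \<sigma> i}"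

text \<open>
  The Bayer--Diaconis formula. Since \<open>rising_sequences n \<sigma> \<le> n\<close> for \<open>n \<ge> 1\<close>, the natural
  number subtraction does not truncate, and the binomial coefficient vanishes when
  \<open>m < rising_sequences n \<sigma>\<close>.
\<close>

definition m_shuffle :: "nat \<Rightarrow> nat \<Rightarrow> (nat \<Rightarrow> nat) \<Rightarrow> real" where
  "m_shuffle n m \<sigma> =
     (if \<sigma> \<in> arrangements n
      then real ((n + m - rising_sequences n \<sigma>) choose n) / real m ^ n else 0)"

definition p_shuffle :: "nat \<Rightarrow> nat pmf \<Rightarrow> (nat \<Rightarrow> nat) \<Rightarrow> real" where
  "p_shuffle n p \<sigma> = (\<Sum>\<^sub>\<infinity>m\<in>{1..}. pmf p m * m_shuffle n m \<sigma>)"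

text \<open>
  A shuffle that turns the ordered deck into \<open>\<pi>\<close> turns the arrangement \<open>\<tau>\<close> into \<open>\<tau> \<circ> \<pi>\<close>.
\<close>

definition convolution ::
  "nat \<Rightarrow> ((nat \<Rightarrow> nat) \<Rightarrow> real) \<Rightarrow> ((nat \<Rightarrow> nat) \<Rightarrow> real) \<Rightarrow> (nat \<Rightarrow> nat) \<Rightarrow> real" where
  "convolution n P Q \<sigma> = (\<Sum>\<tau>\<in>arrangements n. P \<tau> * Q (inv \<tau> \<circ> \<sigma>))"

primrec convolution_power ::
  "nat \<Rightarrow> ((nat \<Rightarrow> nat) \<Rightarrow> real) \<Rightarrow> nat \<Rightarrow> (nat \<Rightarrow> nat) \<Rightarrow> real" where
  "convolution_power n Q 0 = (\<lambda>\<sigma>. if \<sigma> = id then 1 else 0)"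
| "convolution_power n Q (Suc k) = convolution n (convolution_power n Q k) Q"

definition tv_dist ::
  "nat \<Rightarrow> ((nat \<Rightarrow> nat) \<Rightarrow> real) \<Rightarrow> ((nat \<Rightarrow> nat) \<Rightarrow> real) \<Rightarrow> real" where
  "tv_dist n \<mu> \<nu> = (SUP A\<in>Pow (arrangements n). (\<Sum>\<sigma>\<in>A. \<mu> \<sigma>) - (\<Sum>\<sigma>\<in>A. \<nu> \<sigma>))"

text \<open>
  Critical times are extended reals because they may be infinite for finitely many \<open>n\<close>.
\<close>

definition tv_cutoff :: "(nat \<Rightarrow> (nat \<Rightarrow> nat) \<Rightarrow> real) \<Rightarrow> (nat \<Rightarrow> ereal) \<Rightarrow> bool" where
  "tv_cutoff Q t \<longleftrightarrow>
     (\<forall>\<^sub>F n in sequentially. 0 < t n \<and> t n < \<infinity>) \<and>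
     (\<forall>\<epsilon>::real. 0 < \<epsilon> \<and> \<epsilon> < 1 \<longrightarrow>
        (\<forall>k :: nat \<Rightarrow> nat.
           (\<forall>\<^sub>F n in sequentially. ereal (real (k n)) > ereal (1 + \<epsilon>) * t n) \<longrightarrow>
           (\<lambda>n. tv_dist n (convolution_power n (Q n) (k n)) (uniform_mass n)) \<longlonglongrightarrow> 0) \<and>
        (\<forall>k :: nat \<Rightarrow> nat.
           (\<forall>\<^sub>F n in sequentially. ereal (real (k n)) < ereal (1 - \<epsilon>) * t n) \<longrightarrow>
           (\<lambda>n. tv_dist n (convolution_power n (Q n) (k n)) (uniform_mass n)) \<longlonglongrightarrow> 1))"

text \<open>
  The truncations \<open>Y\<close> and \<open>Z\<close> of \<open>log X\<close> at level \<open>a\<close>, as functions of the value of \<open>X\<close>.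
\<close>

definition trunc_Y :: "real \<Rightarrow> nat \<Rightarrow> real" where
  "trunc_Y a x = (if ln (real x) \<le> a then ln (real x) else 0)"

definition trunc_Z :: "real \<Rightarrow> nat \<Rightarrow> real" where
  "trunc_Z a x = (if ln (real x) \<le> a then ln (real x) else a)"

definition EY :: "nat pmf \<Rightarrow> real \<Rightarrow> real" where
  "EY p a = measure_pmf.expectation p (trunc_Y a)"

definition EZ2 :: "nat pmf \<Rightarrow> real \<Rightarrow> real" where
  "EZ2 p a = measure_pmf.expectation p (\<lambda>x. (trunc_Z a x)\<^sup>2)"

end

theory Submission
  imports Defs "HOL-Real_Asymp.Real_Asymp"
begin

text \<open>
  Many shuffles amount to a single one with a random number of packs, and a single shuffle passes
  from far from uniform to nearly uniform as its number of packs passes \<open>n powr (3/2)\<close>. Cutoff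
  then follows from the concentration of the logarithm of the random number of packs.

  \<^bold>\<open>Reduction to one shuffle.\<close> Write a digit below \<open>m\<close> on each of \<open>n\<close> positions. The number of
  digit strings whose stable sort is \<open>inv \<sigma>\<close> is the binomial coefficient in the
  Bayer--Diaconis formula, so an \<open>m\<close>-shuffle is the inverse of sorting by uniform digits
  (\<open>m_shuffle_eq_card\<close>). Sorting by one digit and then by a more significant one is sorting
  by a two-digit number, hence \<open>Q\<^sub>m * Q\<^sub>m' = Q\<^sub>m\<^sub>m'\<close>
  (\<open>convolution_m_shuffle\<close>). Consequently \<open>k\<close> independent \<open>p\<close>-shuffles are one
  \<open>M\<close>-shuffle with the random pack number \<open>M = X\<^sub>1 \<dots> X\<^sub>k\<close>
  (\<open>convolution_power_eq_mixture\<close>).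

  \<^bold>\<open>One shuffle mixes at \<open>m = n powr (3/2)\<close>.\<close> Let \<open>h\<close> be the number of rising sequences minus its
  uniform mean. Relative to the uniform distribution, \<open>Q\<^sub>m\<close> has density
  \<open>\<Prod>i<n. 1 + (c\<^sub>i - h) / m\<close> with \<open>c\<^sub>i = (n - 1) / 2 - i\<close>, which is about
  \<open>exp (- n h / m - n\<^sup>3 / (24 m\<^sup>2))\<close>. Under the uniform distribution \<open>h\<close> has order \<open>sqrt n\<close>. If
  \<open>m\<close> is much larger than \<open>n powr (3/2)\<close>, the density is therefore close to 1
  (\<open>m_shuffle_near_uniform\<close>). If \<open>m\<close> is much smaller, the density is negligible wherever
  \<open>h > - b\<close>, for some \<open>b\<close> larger than \<open>sqrt n\<close>, so the event \<open>h \<le> - b\<close> is almost sure for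
  \<open>Q\<^sub>m\<close> and almost impossible for the uniform distribution
  (\<open>m_shuffle_low_rise_excess_ge\<close>, \<open>uniform_low_rise_excess_le\<close>). The event does not depend
  on \<open>m\<close>, and so it also separates mixtures over small \<open>m\<close>.

  \<^bold>\<open>Concentration of \<open>ln M\<close>.\<close> It remains to compare \<open>ln M = \<Sum>i. ln X\<^sub>i\<close> with \<open>(3/2) ln n\<close>. Since
  \<open>ln X \<ge> Z\<close> and \<open>E Z \<ge> E Y\<close>, Chebyshev's inequality for \<open>Z\<close> bounds \<open>ln M\<close> from below after the
  critical time (\<open>prob_few_packs_le\<close>). Before it, no \<open>ln X\<^sub>i\<close> exceeds \<open>a\<close> except with
  probability \<open>k E Z\<^sup>2 / a\<^sup>2\<close>, and otherwise \<open>ln M\<close> is the sum of the \<open>Y\<^sub>i\<close>, to which Chebyshev's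
  inequality applies (\<open>prob_many_packs_le\<close>). As \<open>k\<close> is comparable to \<open>ln n / E Y\<close>, the truncation costs a
  multiple of \<open>ln n E Z\<^sup>2 / (a\<^sup>2 E Y)\<close> and Chebyshev's inequality a multiple of
  \<open>E Z\<^sup>2 / (ln n E Y)\<close>. The first quantity tends to 0 by hypothesis, and it dominates the
  second because \<open>a = O(ln n)\<close>.
\<close>

section \<open>Stable sorting of digit strings\<close>

lemma strict_mono_on_interval_if_step:
  fixes f :: "nat \<Rightarrow> nat"
  assumes step: "\<And>i. i \<in> {1..<n} \<Longrightarrow> f i < f (Suc i)"
  shows "strict_mono_on {1..n} f"
proof (rule strict_mono_onI)
  fix i j assume ij: "i \<in> {1..n}" "j \<in> {1..n}" "i < j"
  from ij(3,2) show "f i < f j"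
  proof (induction j)
    case (Suc j)
    then show ?case
      using step[of j] ij(1) by (cases "i = j") auto
  qed simp
qed

text \<open>
  Listing the values of a strictly increasing function gives the sorted list of its image,
  which is determined by the image.
\<close>

lemma strict_mono_on_eq_if_same_image:
  fixes f g :: "nat \<Rightarrow> nat"
  assumes f: "strict_mono_on {1..n} f" and g: "strict_mono_on {1..n} g"
    and im: "f ` {1..n} = g ` {1..n}" and i: "i \<in> {1..n}"
  shows "f i = g i"
proof -
  have *: "sorted (map h [1..<Suc n]) \<and> distinct (map h [1..<Suc n])"
    if "strict_mono_on {1..n} h" for h :: "nat \<Rightarrow> nat"
  proof -
    have "sorted_wrt (<) (map h [1..<Suc n])"
      unfolding sorted_wrt_map
      by (rule sorted_wrt_mono_rel[OF _ sorted_wrt_upt])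
        (rule strict_mono_onD[OF that], auto simp del: upt_Suc)
    then show ?thesis by (simp only: strict_sorted_iff)
  qed
  have "map f [1..<Suc n] = map g [1..<Suc n]"
    by (rule sorted_distinct_set_unique)
      (use *[OF f] *[OF g] im in \<open>auto simp del: upt_Suc simp: atLeastLessThanSuc_atLeastAtMost\<close>)
  then show ?thesis using i by (auto simp del: upt_Suc)
qed

lemma ex_strict_mono_on_image:
  fixes A :: "nat set"
  assumes "finite A" "card A = n"
  obtains f where "strict_mono_on {1..n} f" "f ` {1..n} = A"
proof -
  obtain h where h: "bij_betw h {..<n} A" "strict_mono_on {..<n} h"
    using ex_bij_betw_strict_mono_card[OF assms(1)] assms(2) by metis
  show ?thesis
  proof (rule that)
    show "strict_mono_on {1..n} (\<lambda>i. h (i - 1))"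
      by (rule strict_mono_onI) (rule strict_mono_onD[OF h(2)], auto)
    have "(\<lambda>i. h (i - 1)) ` {1..n} = h ` ((\<lambda>i. i - 1) ` {1..n})" by (simp add: image_image)
    also have "(\<lambda>i. i - 1) ` {1..n} = {..<n}"
    proof safe
      fix j assume "j < n"
      then show "j \<in> (\<lambda>i. i - 1) ` {1..n}" by (intro image_eqI[of _ _ "Suc j"]) auto
    qed auto
    finally show "(\<lambda>i. h (i - 1)) ` {1..n} = A"
      using h(1) by (simp add: bij_betw_def)
  qed
qed

lemma ex1_sorting_permutation:
  fixes k :: "nat \<Rightarrow> nat"
  assumes inj: "inj_on k {1..n}"
  shows "\<exists>!\<pi>. \<pi> permutes {1..n} \<and> strict_mono_on {1..n} (\<lambda>i. k (\<pi> i))"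
proof (rule ex_ex1I)
  have "card (k ` {1..n}) = n" using card_image[OF inj] by simp
  then obtain f where f: "strict_mono_on {1..n} f" "f ` {1..n} = k ` {1..n}"
    using ex_strict_mono_on_image[of "k ` {1..n}" n] by auto
  define \<pi> where "\<pi> i = (if i \<in> {1..n} then inv_into {1..n} k (f i) else i)" for i
  have k\<pi>: "k (\<pi> i) = f i" if "i \<in> {1..n}" for i
  proof -
    have "f i \<in> k ` {1..n}" using that f(2) by blast
    then show ?thesis using that unfolding \<pi>_def by (simp add: f_inv_into_f)
  qed
  have "inj_on f {1..n}" by (rule strict_mono_on_imp_inj_on[OF f(1)])
  then have fb: "bij_betw f {1..n} (k ` {1..n})" using f(2) by (simp add: bij_betw_def)
  have "bij_betw (inv_into {1..n} k \<circ> f) {1..n} {1..n}"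
    by (rule bij_betw_trans[OF fb]) (rule bij_betw_inv_into, use inj in \<open>simp add: bij_betw_def\<close>)
  then have "bij_betw \<pi> {1..n} {1..n}"
    by (rule bij_betw_cong[THEN iffD1, rotated]) (auto simp: \<pi>_def)
  then have "\<pi> permutes {1..n}"
    by (rule bij_imp_permutes) (auto simp: \<pi>_def)
  moreover have "strict_mono_on {1..n} (\<lambda>i. k (\<pi> i))"
  proof (rule strict_mono_onI)
    fix i j assume "i \<in> {1..n}" "j \<in> {1..n}" "i < j"
    then show "k (\<pi> i) < k (\<pi> j)" using strict_mono_onD[OF f(1)] k\<pi> by metis
  qed
  ultimately show "\<exists>\<pi>. \<pi> permutes {1..n} \<and> strict_mono_on {1..n} (\<lambda>i. k (\<pi> i))"
    by blast
next
  fix \<pi> \<rho>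
  assume p: "\<pi> permutes {1..n} \<and> strict_mono_on {1..n} (\<lambda>i. k (\<pi> i))"
    and r: "\<rho> permutes {1..n} \<and> strict_mono_on {1..n} (\<lambda>i. k (\<rho> i))"
  have im: "(\<lambda>i. k (\<pi> i)) ` {1..n} = (\<lambda>i. k (\<rho> i)) ` {1..n}"
    using permutes_image[of \<pi> "{1..n}"] permutes_image[of \<rho> "{1..n}"] p r
    by (metis image_image)
  show "\<pi> = \<rho>"
  proof
    fix i
    show "\<pi> i = \<rho> i"
    proof (cases "i \<in> {1..n}")
      case True
      then have "k (\<pi> i) = k (\<rho> i)"
        using strict_mono_on_eq_if_same_image[OF _ _ im True] p r by simp
      then show ?thesis
        using inj True p r by (metis inj_onD permutes_in_image)
    next
      case False
      then show ?thesis using p r by (metis permutes_not_in)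
    qed
  qed
qed

text \<open>
  Positions are at most \<open>n\<close>, so the factor \<open>Suc n\<close> makes the order of these keys the lexicographic
  order of (digit, position): sorting by the key is stable sorting by the digit.
\<close>

definition digit_key :: "nat \<Rightarrow> (nat \<Rightarrow> nat) \<Rightarrow> nat \<Rightarrow> nat" where
  "digit_key n d x = d x * Suc n + x"

definition sorts :: "nat \<Rightarrow> (nat \<Rightarrow> nat) \<Rightarrow> (nat \<Rightarrow> nat) \<Rightarrow> bool" where
  "sorts n d \<pi> \<longleftrightarrow> \<pi> permutes {1..n} \<and> strict_mono_on {1..n} (\<lambda>i. digit_key n d (\<pi> i))"

lemma lex_less_iff:
  fixes u v x y b :: nat
  assumes "x < b" "y < b"
  shows "u * b + x < v * b + y \<longleftrightarrow> u < v \<or> u = v \<and> x < y"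
proof -
  consider "u < v" | "u = v" | "v < u" by linarith
  then show ?thesis
  proof cases
    case 1
    then have "Suc u * b \<le> v * b" by (intro mult_right_mono) auto
    then show ?thesis using 1 assms by auto
  next
    case 2
    then show ?thesis by auto
  next
    case 3
    then have "Suc v * b \<le> u * b" by (intro mult_right_mono) auto
    then show ?thesis using 3 assms by auto
  qed
qed

lemma digit_key_less_iff:
  assumes "x \<in> {1..n}" "y \<in> {1..n}"
  shows "digit_key n d x < digit_key n d y \<longleftrightarrow> d x < d y \<or> d x = d y \<and> x < y"
  unfolding digit_key_def by (rule lex_less_iff) (use assms in auto)

lemma inj_on_digit_key: "inj_on (digit_key n d) {1..n}"
  by (rule inj_onI) (metis digit_key_less_iff less_irrefl linorder_neqE_nat)

lemma ex1_sorts: "\<exists>!\<pi>. sorts n d \<pi>"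
  unfolding sorts_def by (rule ex1_sorting_permutation[OF inj_on_digit_key])

definition stable_sort :: "nat \<Rightarrow> (nat \<Rightarrow> nat) \<Rightarrow> nat \<Rightarrow> nat" where
  "stable_sort n d = (THE \<pi>. sorts n d \<pi>)"

lemma sorts_iff_stable_sort: "sorts n d \<pi> \<longleftrightarrow> stable_sort n d = \<pi>"
  unfolding stable_sort_def using ex1_sorts[of n d] by (metis theI')

lemma stable_sort_permutes: "stable_sort n d permutes {1..n}"
  using sorts_iff_stable_sort[of n d "stable_sort n d"] by (simp add: sorts_def)

lemma stable_sort_less:
  assumes "i \<in> {1..n}" "j \<in> {1..n}" "i < j"
  shows "d (stable_sort n d i) < d (stable_sort n d j) \<or>
    d (stable_sort n d i) = d (stable_sort n d j) \<and> stable_sort n d i < stable_sort n d j"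
proof -
  have "strict_mono_on {1..n} (\<lambda>i. digit_key n d (stable_sort n d i))"
    using sorts_iff_stable_sort[of n d "stable_sort n d"] by (simp add: sorts_def)
  from strict_mono_onD[OF this assms]
  show ?thesis
    using assms(1,2) permutes_in_image[OF stable_sort_permutes]
    by (subst (asm) digit_key_less_iff) auto
qed

lemma stable_sort_eqI:
  assumes "\<pi> permutes {1..n}"
    and "\<And>i j. i \<in> {1..n} \<Longrightarrow> j \<in> {1..n} \<Longrightarrow> i < j \<Longrightarrow>
      d (\<pi> i) < d (\<pi> j) \<or> d (\<pi> i) = d (\<pi> j) \<and> \<pi> i < \<pi> j"
  shows "stable_sort n d = \<pi>"
  unfolding sorts_iff_stable_sort[symmetric] sorts_def
  using assms permutes_in_image[OF assms(1)]
  by (auto intro!: strict_mono_onI simp: digit_key_less_iff)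

section \<open>The digit model of the m-shuffle\<close>

definition digit_strings :: "nat \<Rightarrow> nat \<Rightarrow> (nat \<Rightarrow> nat) set" where
  "digit_strings n m = {1..n} \<rightarrow>\<^sub>E {..<m}"

lemma finite_digit_strings: "finite (digit_strings n m)"
  unfolding digit_strings_def by (intro finite_PiE) auto

lemma card_digit_strings: "card (digit_strings n m) = m ^ n"
  unfolding digit_strings_def by (simp add: card_PiE)

lemma digit_strings_eqI:
  assumes "d \<in> digit_strings n m" "e \<in> digit_strings n m" "\<And>x. x \<in> {1..n} \<Longrightarrow> d x = e x"
  shows "d = e"
  using assms unfolding digit_strings_def by (rule PiE_ext)

definition descents :: "nat \<Rightarrow> (nat \<Rightarrow> nat) \<Rightarrow> nat set" where
  "descents n \<pi> = {i \<in> {1..<n}. \<pi> (Suc i) < \<pi> i}"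

text \<open>
  Adding this correction to a digit string read in sorted order turns its weak increases, which
  are allowed exactly at the ascents of the sorting permutation, into strict ones.
\<close>

definition ascents_before :: "(nat \<Rightarrow> nat) \<Rightarrow> nat \<Rightarrow> nat" where
  "ascents_before \<pi> i = card {j \<in> {1..<i}. \<pi> j < \<pi> (Suc j)}"

lemma ascents_before_Suc:
  assumes "i \<ge> 1"
  shows "ascents_before \<pi> (Suc i) = ascents_before \<pi> i + (if \<pi> i < \<pi> (Suc i) then 1 else 0)"
proof -
  have "{j \<in> {1..<Suc i}. \<pi> j < \<pi> (Suc j)} =
      {j \<in> {1..<i}. \<pi> j < \<pi> (Suc j)} \<union> (if \<pi> i < \<pi> (Suc i) then {i} else {})"
    using assms by (auto simp: less_Suc_eq)
  then show ?thesis
    unfolding ascents_before_def by (simp add: card_Un_disjoint)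
qed

lemma ascents_before_last:
  assumes \<pi>: "\<pi> permutes {1..n}" and "n \<ge> 1"
  shows "ascents_before \<pi> n + card (descents n \<pi>) = n - 1"
proof -
  have ne: "\<pi> j \<noteq> \<pi> (Suc j)" for j
    using permutes_inj[OF \<pi>] by (metis injD n_not_Suc_n)
  have "ascents_before \<pi> n + card (descents n \<pi>) =
      card ({j \<in> {1..<n}. \<pi> j < \<pi> (Suc j)} \<union> descents n \<pi>)"
    unfolding ascents_before_def descents_def by (subst card_Un_disjoint) auto
  also have "{j \<in> {1..<n}. \<pi> j < \<pi> (Suc j)} \<union> descents n \<pi> = {1..<n}"
    unfolding descents_def by (auto simp: not_less le_less ne)
  finally show ?thesis by simp
qed

lemma shifted_digits_step:
  assumes d: "stable_sort n d = \<pi>" and i: "i \<in> {1..<n}"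
  shows "d (\<pi> i) + ascents_before \<pi> i < d (\<pi> (Suc i)) + ascents_before \<pi> (Suc i)"
proof -
  have "d (\<pi> i) < d (\<pi> (Suc i)) \<or> d (\<pi> i) = d (\<pi> (Suc i)) \<and> \<pi> i < \<pi> (Suc i)"
    using stable_sort_less[of i n "Suc i" d] d i by auto
  then show ?thesis using i by (auto simp: ascents_before_Suc)
qed

text \<open>
  The correction can be undone: a strictly increasing \<open>f\<close> grows by at least 1 at every ascent, so
  subtracting the ascents seen so far leaves digits that never decrease and still grow strictly
  at the descents, as stable sorting demands.
\<close>

lemma ex_digits_with_shift:
  assumes \<pi>: "\<pi> permutes {1..n}" and n: "n \<ge> 1"
    and f: "strict_mono_on {1..n} f" and bd: "\<And>i. i \<in> {1..n} \<Longrightarrow> f i + Suc (card (descents n \<pi>)) < n + m"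
  obtains d where "d \<in> digit_strings n m" "stable_sort n d = \<pi>"
    "\<And>i. i \<in> {1..n} \<Longrightarrow> d (\<pi> i) + ascents_before \<pi> i = f i"
proof -
  define e where "e i = f i - ascents_before \<pi> i" for i
  have fstep: "f i < f (Suc i)" if "i \<in> {1..<n}" for i
    using that by (intro strict_mono_onD[OF f]) auto
  have asc: "ascents_before \<pi> i \<le> f i" if "i \<in> {1..n}" for i
  proof -
    have "1 \<le> i" "i \<le> n" using that by auto
    then show ?thesis
    proof (induction i rule: dec_induct)
      case base
      then show ?case by (simp add: ascents_before_def)
    next
      case (step i)
      then show ?case using fstep[of i] ascents_before_Suc[of i \<pi>] by auto
    qed
  qed
  have e: "e i + ascents_before \<pi> i = f i" if "i \<in> {1..n}" for i
    using asc[OF that] by (simp add: e_def)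
  define d where "d = restrict (\<lambda>x. e (inv \<pi> x)) {1..n}"
  have d\<pi>: "d (\<pi> i) = e i" if "i \<in> {1..n}" for i
    using that permutes_in_image[OF \<pi>] permutes_inverses(2)[OF \<pi>] by (simp add: d_def)
  have \<pi>in: "\<pi> i \<in> {1..n}" if "i \<in> {1..n}" for i
    using that permutes_in_image[OF \<pi>] by simp
  have mono: "strict_mono_on {1..n} (\<lambda>i. digit_key n d (\<pi> i))"
  proof (rule strict_mono_on_interval_if_step)
    fix i assume i: "i \<in> {1..<n}"
    then have i': "i \<in> {1..n}" "Suc i \<in> {1..n}" by auto
    have ne: "\<pi> i \<noteq> \<pi> (Suc i)" using permutes_inj[OF \<pi>] by (metis injD n_not_Suc_n)
    show "digit_key n d (\<pi> i) < digit_key n d (\<pi> (Suc i))"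
      unfolding digit_key_less_iff[OF \<pi>in[OF i'(1)] \<pi>in[OF i'(2)]] d\<pi>[OF i'(1)] d\<pi>[OF i'(2)]
      using e[OF i'(1)] e[OF i'(2)] fstep[OF i] ascents_before_Suc[of i \<pi>] i ne
      by (auto split: if_splits)
  qed
  have "stable_sort n d = \<pi>"
    using mono \<pi> by (simp add: sorts_iff_stable_sort[symmetric] sorts_def)
  moreover have "d \<in> digit_strings n m"
  proof -
    have top: "e n < m"
      using bd[of n] e[of n] ascents_before_last[OF \<pi> n] n by auto
    have "e i < m" if i: "i \<in> {1..n}" for i
    proof (cases "i = n")
      case False
      then have "digit_key n d (\<pi> i) < digit_key n d (\<pi> n)"
        using i n by (intro strict_mono_onD[OF mono]) auto
      then have "e i \<le> e n"
        using i n d\<pi>[of i] d\<pi>[of n] \<pi>in[of i] \<pi>in[of n] by (auto simp: digit_key_less_iff)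
      then show ?thesis using top by simp
    qed (use top in simp)
    then show ?thesis
      using permutes_in_image[OF permutes_inv[OF \<pi>]] unfolding digit_strings_def d_def by auto
  qed
  ultimately show ?thesis using that d\<pi> e by simp
qed

text \<open>
  By the correction for ascents, a digit string with stable sort \<open>\<pi>\<close> amounts to a strictly
  increasing function on \<open>n\<close> points, that is, to its image. The largest value is less than \<open>m\<close>
  plus the number of ascents, and there are \<open>n - 1 - card (descents n \<pi>)\<close> ascents; this is
  where the upper entry of the binomial coefficient comes from.
\<close>

lemma card_digit_strings_with_sort:
  assumes \<pi>: "\<pi> permutes {1..n}" and n: "n \<ge> 1"
  shows "card {d \<in> digit_strings n m. stable_sort n d = \<pi>} =
    (n + m - Suc (card (descents n \<pi>))) choose n"
proof -
  let ?D = "{d \<in> digit_strings n m. stable_sort n d = \<pi>}"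
  let ?N = "n + m - Suc (card (descents n \<pi>))"
  define F where "F d = (\<lambda>i. d (\<pi> i) + ascents_before \<pi> i)" for d
  have \<pi>in: "\<pi> i \<in> {1..n}" if "i \<in> {1..n}" for i
    using that permutes_in_image[OF \<pi>] by simp
  have mono: "strict_mono_on {1..n} (F d)" if "stable_sort n d = \<pi>" for d
    unfolding F_def by (rule strict_mono_on_interval_if_step) (rule shifted_digits_step[OF that])
  have "bij_betw (\<lambda>d. F d ` {1..n}) ?D {A. A \<subseteq> {..<?N} \<and> card A = n}"
  proof (rule bij_betwI')
    fix d e assume d: "d \<in> ?D" and e: "e \<in> ?D"
    show "(F d ` {1..n} = F e ` {1..n}) = (d = e)"
    proof
      assume im: "F d ` {1..n} = F e ` {1..n}"
      have eq: "d (\<pi> i) = e (\<pi> i)" if "i \<in> {1..n}" for i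
        using strict_mono_on_eq_if_same_image[OF mono mono im that] d e by (simp add: F_def)
      show "d = e"
      proof (rule digit_strings_eqI[of _ n m])
        fix x assume "x \<in> {1..n}"
        then show "d x = e x"
          using eq[of "inv \<pi> x"] permutes_in_image[OF permutes_inv[OF \<pi>]] permutes_inverses(1)[OF \<pi>]
          by simp
      qed (use d e in auto)
    qed simp
  next
    fix d assume d: "d \<in> ?D"
    have "F d i < ?N" if i: "i \<in> {1..n}" for i
    proof -
      have "F d i \<le> F d n"
        using i n strict_mono_onD[OF mono, of d i n] d by (cases "i = n") (auto intro: less_imp_le)
      moreover have "d (\<pi> n) < m" using d \<pi>in[of n] n unfolding digit_strings_def by auto
      ultimately show ?thesis
        using ascents_before_last[OF \<pi> n] n unfolding F_def by linarith
    qed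
    moreover have "card (F d ` {1..n}) = n"
      using card_image[OF strict_mono_on_imp_inj_on[OF mono]] d by simp
    ultimately show "F d ` {1..n} \<in> {A. A \<subseteq> {..<?N} \<and> card A = n}" by auto
  next
    fix A assume A: "A \<in> {A. A \<subseteq> {..<?N} \<and> card A = n}"
    then have "finite A" "card A = n" by (auto intro: finite_subset)
    then obtain f where f: "strict_mono_on {1..n} f" "f ` {1..n} = A"
      by (rule ex_strict_mono_on_image)
    have "f i + Suc (card (descents n \<pi>)) < n + m" if "i \<in> {1..n}" for i
    proof -
      have "f i < ?N" using f(2) A imageI[OF that, of f] by blast
      then show ?thesis by linarith
    qed
    then obtain d where d: "d \<in> digit_strings n m" "stable_sort n d = \<pi>"
      "\<And>i. i \<in> {1..n} \<Longrightarrow> d (\<pi> i) + ascents_before \<pi> i = f i"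
      using ex_digits_with_shift[OF \<pi> n f(1)] by metis
    have "F d ` {1..n} = A" using d(3) f(2) unfolding F_def by auto
    then show "\<exists>d\<in>?D. A = F d ` {1..n}" using d(1,2) by auto
  qed
  then have "card ?D = card {A. A \<subseteq> {..<?N} \<and> card A = n}" by (rule bij_betw_same_card)
  then show ?thesis using n_subsets[of "{..<?N}" n] by simp
qed

lemma rising_sequences_eq: "rising_sequences n \<sigma> = Suc (card (descents n (inv \<sigma>)))"
  by (simp add: rising_sequences_def descents_def)

lemma m_shuffle_eq_card:
  assumes "\<sigma> \<in> arrangements n" "n \<ge> 1"
  shows "m_shuffle n m \<sigma> =
    real (card {d \<in> digit_strings n m. stable_sort n d = inv \<sigma>}) / real m ^ n"
  using assms card_digit_strings_with_sort[OF permutes_inv, of \<sigma> n m]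
  by (simp add: m_shuffle_def rising_sequences_eq arrangements_def)

lemma m_shuffle_nonneg: "m_shuffle n m \<sigma> \<ge> 0"
  by (simp add: m_shuffle_def)

lemma finite_arrangements: "finite (arrangements n)"
  unfolding arrangements_def by (rule finite_permutations) simp

lemma card_arrangements: "card (arrangements n) = fact n"
  unfolding arrangements_def using card_permutations[of "{1..n}" n] by simp

lemma inv_arrangements: "\<sigma> \<in> arrangements n \<Longrightarrow> inv \<sigma> \<in> arrangements n"
  unfolding arrangements_def by (simp add: permutes_inv)

lemma inv_arrangements_eqD:
  assumes "inv \<sigma> = inv \<tau>" "\<sigma> \<in> arrangements n" "\<tau> \<in> arrangements n"
  shows "\<sigma> = \<tau>"
  using assms permutes_inv_inv unfolding arrangements_def by (metis mem_Collect_eq)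

text \<open>
  Every digit string has exactly one stable sort, so the counts add up to \<open>m ^ n\<close>.
\<close>

lemma sum_m_shuffle:
  assumes n: "n \<ge> 1" and m: "m \<ge> 1"
  shows "(\<Sum>\<sigma>\<in>arrangements n. m_shuffle n m \<sigma>) = 1"
proof -
  have "(\<Sum>\<sigma>\<in>arrangements n. card {d \<in> digit_strings n m. stable_sort n d = inv \<sigma>}) =
      card (\<Union>\<sigma>\<in>arrangements n. {d \<in> digit_strings n m. stable_sort n d = inv \<sigma>})"
    by (rule card_UN_disjoint[symmetric])
      (auto simp: finite_arrangements finite_digit_strings dest: inv_arrangements_eqD)
  also have "(\<Union>\<sigma>\<in>arrangements n. {d \<in> digit_strings n m. stable_sort n d = inv \<sigma>}) = digit_strings n m"
  proof -
    have "\<exists>\<sigma>\<in>arrangements n. stable_sort n d = inv \<sigma>" for d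
      using stable_sort_permutes[of n d] permutes_inv_inv[OF stable_sort_permutes, of n d]
      by (intro bexI[of _ "inv (stable_sort n d)"]) (auto simp: arrangements_def permutes_inv)
    then show ?thesis by auto
  qed
  finally have "(\<Sum>\<sigma>\<in>arrangements n. real (card {d \<in> digit_strings n m. stable_sort n d = inv \<sigma>})) =
      real (m ^ n)"
    by (simp add: card_digit_strings flip: of_nat_sum)
  then show ?thesis
    using n m by (simp add: m_shuffle_eq_card flip: sum_divide_distrib)
qed

text \<open>
  Sorting first by the digits \<open>d'\<close> moves position \<open>x\<close> to the place \<open>inv (stable_sort n d') x\<close>, where
  it receives the digit of \<open>d\<close>. The merged digit makes the later sort the more significant one.
\<close>

definition merge_digits :: "nat \<Rightarrow> nat \<Rightarrow> (nat \<Rightarrow> nat) \<times> (nat \<Rightarrow> nat) \<Rightarrow> nat \<Rightarrow> nat" where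
  "merge_digits n m' = (\<lambda>(d, d'). restrict (\<lambda>x. d (inv (stable_sort n d') x) * m' + d' x) {1..n})"

text \<open>
  This is the principle of radix sort: a stable sort by the high digit keeps the order that an
  earlier stable sort by the low digit has produced among equal high digits.
\<close>

lemma stable_sort_merge_digits:
  assumes d': "d' \<in> digit_strings n m'"
  shows "stable_sort n (merge_digits n m' (d, d')) = stable_sort n d' \<circ> stable_sort n d"
proof (rule stable_sort_eqI)
  let ?a = "stable_sort n d" and ?b = "stable_sort n d'" and ?D = "merge_digits n m' (d, d')"
  show "?b \<circ> ?a permutes {1..n}"
    by (intro permutes_compose stable_sort_permutes)
  have a: "?a i \<in> {1..n}" and b: "?b i \<in> {1..n}" if "i \<in> {1..n}" for i
    using that permutes_in_image[OF stable_sort_permutes] by simp_all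
  have D: "?D (?b (?a i)) = d (?a i) * m' + d' (?b (?a i))" if "i \<in> {1..n}" for i
    using a[OF that] b[OF a[OF that]] permutes_inverses(2)[OF stable_sort_permutes]
    by (simp add: merge_digits_def)
  have lt: "d' (?b (?a i)) < m'" if "i \<in> {1..n}" for i
    using d' b[OF a[OF that]] unfolding digit_strings_def by auto
  fix i j assume i: "i \<in> {1..n}" and j: "j \<in> {1..n}" and ij: "i < j"
  have "?D (?b (?a i)) < ?D (?b (?a j)) \<or>
    ?D (?b (?a i)) = ?D (?b (?a j)) \<and> ?b (?a i) < ?b (?a j)"
    using stable_sort_less[OF i j ij, of d]
  proof
    assume "d (?a i) < d (?a j)"
    then show ?thesis unfolding D[OF i] D[OF j] using lex_less_iff[OF lt[OF i] lt[OF j]] by blast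
  next
    assume *: "d (?a i) = d (?a j) \<and> ?a i < ?a j"
    then show ?thesis unfolding D[OF i] D[OF j] using stable_sort_less[OF a[OF i] a[OF j], of d'] by auto
  qed
  then show "?D ((?b \<circ> ?a) i) < ?D ((?b \<circ> ?a) j) \<or>
      ?D ((?b \<circ> ?a) i) = ?D ((?b \<circ> ?a) j) \<and> (?b \<circ> ?a) i < (?b \<circ> ?a) j"
    by simp
qed

text \<open>
  The low digit, and with it the permutation \<open>stable_sort n d'\<close>, can be read off the merged digit,
  and then the high digit too. Surjectivity follows by counting.
\<close>

lemma bij_betw_merge_digits:
  "bij_betw (merge_digits n m') (digit_strings n m \<times> digit_strings n m') (digit_strings n (m * m'))"
proof -
  let ?P = "digit_strings n m \<times> digit_strings n m'"
  have inj: "inj_on (merge_digits n m') ?P"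
  proof (rule inj_onI, clarify)
    fix d d' e e'
    assume d: "d \<in> digit_strings n m" "d' \<in> digit_strings n m'"
      and e: "e \<in> digit_strings n m" "e' \<in> digit_strings n m'"
      and eq: "merge_digits n m' (d, d') = merge_digits n m' (e, e')"
    have lt: "d' x < m'" "e' x < m'" if "x \<in> {1..n}" for x
      using d(2) e(2) that unfolding digit_strings_def by auto
    have *: "d (inv (stable_sort n d') x) * m' + d' x = e (inv (stable_sort n e') x) * m' + e' x"
      if "x \<in> {1..n}" for x
      using fun_cong[OF eq, of x] that by (simp add: merge_digits_def)
    have **: "d (inv (stable_sort n d') x) = e (inv (stable_sort n e') x) \<and> d' x = e' x"
      if x: "x \<in> {1..n}" for x
      using *[OF x] lex_less_iff[OF lt[OF x]] lex_less_iff[OF lt(2)[OF x] lt(1)[OF x]]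
      by (metis less_irrefl linorder_neqE_nat)
    have d'e': "d' = e'"
      by (rule digit_strings_eqI[OF d(2) e(2)]) (use ** in blast)
    have "d = e"
    proof (rule digit_strings_eqI[OF d(1) e(1)])
      fix x assume "x \<in> {1..n}"
      then have "stable_sort n d' x \<in> {1..n}" using permutes_in_image[OF stable_sort_permutes] by simp
      from **[OF this] show "d x = e x"
        using permutes_inverses(2)[OF stable_sort_permutes] by (simp add: d'e')
    qed
    with d'e' show "d = e \<and> d' = e'" by simp
  qed
  have sub: "merge_digits n m' ` ?P \<subseteq> digit_strings n (m * m')"
  proof clarify
    fix d d' assume d: "d \<in> digit_strings n m" and d': "d' \<in> digit_strings n m'"
    have "d (inv (stable_sort n d') x) * m' + d' x < m * m'" if x: "x \<in> {1..n}" for x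
    proof -
      have "inv (stable_sort n d') x \<in> {1..n}"
        using x permutes_in_image[OF permutes_inv[OF stable_sort_permutes]] by simp
      then have "d (inv (stable_sort n d') x) < m" "d' x < m'"
        using d d' x unfolding digit_strings_def by auto
      then have "d (inv (stable_sort n d') x) * m' + d' x < Suc (d (inv (stable_sort n d') x)) * m'"
        by simp
      also have "\<dots> \<le> m * m'"
        using \<open>d (inv (stable_sort n d') x) < m\<close> by (intro mult_right_mono) auto
      finally show ?thesis .
    qed
    then show "merge_digits n m' (d, d') \<in> digit_strings n (m * m')"
      unfolding digit_strings_def merge_digits_def by auto
  qed
  have "merge_digits n m' ` ?P = digit_strings n (m * m')"
    by (rule card_subset_eq[OF finite_digit_strings sub])
      (simp add: card_image[OF inj] card_cartesian_product card_digit_strings power_mult_distrib)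
  with inj show ?thesis by (simp add: bij_betw_def)
qed

text \<open>
  Both sides count pairs of digit strings: the convolution sorts them one after the other, and the
  merged strings are sorted at once. The identity also holds when \<open>m\<close> or \<open>m'\<close> is 0, as both
  sides then vanish.
\<close>

lemma convolution_m_shuffle:
  assumes \<sigma>: "\<sigma> \<in> arrangements n" and n: "n \<ge> 1"
  shows "convolution n (m_shuffle n m) (m_shuffle n m') \<sigma> = m_shuffle n (m * m') \<sigma>"
proof -
  let ?S = "\<lambda>m \<pi>. {d \<in> digit_strings n m. stable_sort n d = \<pi>}"
  let ?R = "{(d, d') \<in> digit_strings n m \<times> digit_strings n m'. stable_sort n d' \<circ> stable_sort n d = inv \<sigma>}"
  have \<sigma>': "\<sigma> permutes {1..n}" using \<sigma> by (simp add: arrangements_def)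
  have arr: "inv \<tau> \<circ> \<sigma> \<in> arrangements n" if "\<tau> \<in> arrangements n" for \<tau>
    using that \<sigma> by (auto simp: arrangements_def intro: permutes_compose permutes_inv)
  have "convolution n (m_shuffle n m) (m_shuffle n m') \<sigma> =
      (\<Sum>\<tau>\<in>arrangements n. real (card (?S m (inv \<tau>)) * card (?S m' (inv \<sigma> \<circ> \<tau>)))) / real (m * m') ^ n"
    unfolding convolution_def sum_divide_distrib
  proof (rule sum.cong)
    fix \<tau> assume \<tau>: "\<tau> \<in> arrangements n"
    then have \<tau>': "\<tau> permutes {1..n}" by (simp add: arrangements_def)
    have "inv (inv \<tau> \<circ> \<sigma>) = inv \<sigma> \<circ> \<tau>"
      using permutes_bij[OF \<sigma>'] permutes_bij[OF permutes_inv[OF \<tau>']]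
      by (simp add: o_inv_distrib permutes_inv_inv[OF \<tau>'])
    then show "m_shuffle n m \<tau> * m_shuffle n m' (inv \<tau> \<circ> \<sigma>) =
        real (card (?S m (inv \<tau>)) * card (?S m' (inv \<sigma> \<circ> \<tau>))) / real (m * m') ^ n"
      using m_shuffle_eq_card[OF \<tau> n] m_shuffle_eq_card[OF arr[OF \<tau>] n]
      by (simp add: power_mult_distrib)
  qed simp
  also have "(\<Sum>\<tau>\<in>arrangements n. real (card (?S m (inv \<tau>)) * card (?S m' (inv \<sigma> \<circ> \<tau>)))) =
      real (\<Sum>\<tau>\<in>arrangements n. card (?S m (inv \<tau>) \<times> ?S m' (inv \<sigma> \<circ> \<tau>)))"
    by (simp add: card_cartesian_product)
  also have "(\<Sum>\<tau>\<in>arrangements n. card (?S m (inv \<tau>) \<times> ?S m' (inv \<sigma> \<circ> \<tau>))) =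
      card (\<Union>\<tau>\<in>arrangements n. ?S m (inv \<tau>) \<times> ?S m' (inv \<sigma> \<circ> \<tau>))"
    by (rule card_UN_disjoint[symmetric])
      (auto simp: finite_arrangements finite_digit_strings dest: inv_arrangements_eqD)
  also have "(\<Union>\<tau>\<in>arrangements n. ?S m (inv \<tau>) \<times> ?S m' (inv \<sigma> \<circ> \<tau>)) = ?R"
  proof (intro set_eqI iffI)
    fix z assume "z \<in> (\<Union>\<tau>\<in>arrangements n. ?S m (inv \<tau>) \<times> ?S m' (inv \<sigma> \<circ> \<tau>))"
    then obtain \<tau> d d' where z: "z = (d, d')" "\<tau> permutes {1..n}" "d \<in> ?S m (inv \<tau>)"
        "d' \<in> ?S m' (inv \<sigma> \<circ> \<tau>)"
      by (auto simp: arrangements_def)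
    have "(inv \<sigma> \<circ> \<tau>) \<circ> inv \<tau> = inv \<sigma>"
      by (simp add: comp_assoc permutes_inv_o(1)[OF z(2)])
    then show "z \<in> ?R" using z by simp
  next
    fix z assume "z \<in> ?R"
    then obtain d d' where z: "z = (d, d')" "d \<in> digit_strings n m" "d' \<in> digit_strings n m'"
        "stable_sort n d' \<circ> stable_sort n d = inv \<sigma>" by auto
    let ?\<tau> = "inv (stable_sort n d)"
    have "inv \<sigma> \<circ> ?\<tau> = stable_sort n d'"
      unfolding z(4)[symmetric] by (simp add: comp_assoc permutes_inv_o(1)[OF stable_sort_permutes])
    moreover have "inv ?\<tau> = stable_sort n d" by (rule permutes_inv_inv[OF stable_sort_permutes])
    moreover have "?\<tau> \<in> arrangements n"
      by (intro inv_arrangements) (simp only: arrangements_def mem_Collect_eq stable_sort_permutes)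
    ultimately show "z \<in> (\<Union>\<tau>\<in>arrangements n. ?S m (inv \<tau>) \<times> ?S m' (inv \<sigma> \<circ> \<tau>))"
      using z by (intro UN_I[of ?\<tau>]) auto
  qed
  also have "card ?R = card (?S (m * m') (inv \<sigma>))"
  proof (rule bij_betw_same_card)
    have "merge_digits n m' ` ?R = ?S (m * m') (inv \<sigma>)"
      using bij_betw_imp_surj_on[OF bij_betw_merge_digits[of n m' m], symmetric]
      by (auto simp: stable_sort_merge_digits)
    moreover have "inj_on (merge_digits n m') ?R"
      by (rule inj_on_subset[OF bij_betw_imp_inj_on[OF bij_betw_merge_digits[of n m' m]]]) auto
    ultimately show "bij_betw (merge_digits n m') ?R (?S (m * m') (inv \<sigma>))"
      by (simp add: bij_betw_def)
  qed
  also have "real (card (?S (m * m') (inv \<sigma>))) / real (m * m') ^ n = m_shuffle n (m * m') \<sigma>"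
    using m_shuffle_eq_card[OF \<sigma> n] by simp
  finally show ?thesis .
qed

section \<open>Repeated shuffles as mixtures\<close>

lemma integrable_pmf_bounded:
  fixes f :: "'a \<Rightarrow> real"
  assumes "\<And>x. x \<in> set_pmf p \<Longrightarrow> \<bar>f x\<bar> \<le> B"
  shows "integrable (measure_pmf p) f"
  by (rule measure_pmf.integrable_const_bound[where B = B])
    (use assms in \<open>auto simp: AE_measure_pmf_iff\<close>)

lemma abs_expectation_le:
  fixes f :: "'a \<Rightarrow> real"
  assumes "\<And>x. x \<in> set_pmf p \<Longrightarrow> \<bar>f x\<bar> \<le> B"
  shows "\<bar>measure_pmf.expectation p f\<bar> \<le> B"
proof -
  have i: "integrable (measure_pmf p) f" by (rule integrable_pmf_bounded[OF assms])
  have "measure_pmf.expectation p f \<le> B"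
    by (rule measure_pmf.integral_le_const[OF i]) (use assms in \<open>auto simp: AE_measure_pmf_iff abs_le_iff\<close>)
  moreover have "- B \<le> measure_pmf.expectation p f"
    by (rule measure_pmf.integral_ge_const[OF i])
      (use assms in \<open>force simp: AE_measure_pmf_iff abs_le_iff\<close>)
  ultimately show ?thesis by linarith
qed

text \<open>
  Shifting by the bound \<open>B\<close> makes the integrand nonnegative, which reduces the claim to the
  corresponding law for nonnegative integrals.
\<close>

lemma expectation_bind_pmf:
  fixes f :: "'b \<Rightarrow> real"
  assumes bd: "\<And>y. y \<in> set_pmf (bind_pmf M N) \<Longrightarrow> \<bar>f y\<bar> \<le> B"
  shows "measure_pmf.expectation (bind_pmf M N) f =
    measure_pmf.expectation M (\<lambda>x. measure_pmf.expectation (N x) f)"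
proof -
  define g where "g y = f y + B" for y
  have g: "0 \<le> g y" "\<bar>g y\<bar> \<le> 2 * B" if "y \<in> set_pmf (bind_pmf M N)" for y
    using bd[OF that] by (auto simp: g_def)
  have gN: "0 \<le> g y" "\<bar>g y\<bar> \<le> 2 * B" "\<bar>f y\<bar> \<le> B" if "x \<in> set_pmf M" "y \<in> set_pmf (N x)" for x y
  proof -
    have y: "y \<in> set_pmf (bind_pmf M N)" using that by auto
    show "0 \<le> g y" "\<bar>g y\<bar> \<le> 2 * B" "\<bar>f y\<bar> \<le> B" using g[OF y] bd[OF y] by blast+
  qed
  have iN: "integrable (N x) g" "integrable (N x) f" if "x \<in> set_pmf M" for x
    using gN[OF that] by (auto intro: integrable_pmf_bounded[where B = "2 * B"] integrable_pmf_bounded[where B = B])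
  have EN: "\<bar>measure_pmf.expectation (N x) g\<bar> \<le> 2 * B" "0 \<le> measure_pmf.expectation (N x) g"
      "\<bar>measure_pmf.expectation (N x) f\<bar> \<le> B" if "x \<in> set_pmf M" for x
    using gN[OF that] by (auto intro!: abs_expectation_le integral_nonneg_AE simp: AE_measure_pmf_iff)
  have "ennreal (measure_pmf.expectation (bind_pmf M N) g) = (\<integral>\<^sup>+y. ennreal (g y) \<partial>bind_pmf M N)"
    by (rule nn_integral_eq_integral[symmetric])
      (use g in \<open>auto intro!: integrable_pmf_bounded[where B = "2 * B"] simp: AE_measure_pmf_iff\<close>)
  also have "\<dots> = (\<integral>\<^sup>+x. \<integral>\<^sup>+y. ennreal (g y) \<partial>N x \<partial>M)" by simp
  also have "\<dots> = (\<integral>\<^sup>+x. ennreal (measure_pmf.expectation (N x) g) \<partial>M)"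
  proof (rule nn_integral_cong_AE, unfold AE_measure_pmf_iff, intro ballI)
    fix x assume x: "x \<in> set_pmf M"
    show "(\<integral>\<^sup>+y. ennreal (g y) \<partial>N x) = ennreal (measure_pmf.expectation (N x) g)"
      by (rule nn_integral_eq_integral[OF iN(1)[OF x]]) (use gN x in \<open>auto simp: AE_measure_pmf_iff\<close>)
  qed
  also have "\<dots> = ennreal (measure_pmf.expectation M (\<lambda>x. measure_pmf.expectation (N x) g))"
    by (rule nn_integral_eq_integral)
      (use EN in \<open>auto intro!: integrable_pmf_bounded[where B = "2 * B"] simp: AE_measure_pmf_iff\<close>)
  finally have "measure_pmf.expectation (bind_pmf M N) g =
      measure_pmf.expectation M (\<lambda>x. measure_pmf.expectation (N x) g)"
    by (subst (asm) ennreal_inj)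
      (use g EN in \<open>auto intro!: integral_nonneg_AE simp: AE_measure_pmf_iff\<close>)
  moreover have "measure_pmf.expectation (bind_pmf M N) g = measure_pmf.expectation (bind_pmf M N) f + B"
    unfolding g_def using integrable_pmf_bounded[of "bind_pmf M N" f, OF bd] by simp
  moreover have "measure_pmf.expectation M (\<lambda>x. measure_pmf.expectation (N x) g) =
      measure_pmf.expectation M (\<lambda>x. measure_pmf.expectation (N x) f + B)"
  proof (rule integral_cong_AE, simp, simp, unfold AE_measure_pmf_iff, intro ballI)
    fix x assume "x \<in> set_pmf M"
    then show "measure_pmf.expectation (N x) g = measure_pmf.expectation (N x) f + B"
      unfolding g_def using iN(2) by simp
  qed
  moreover have "\<dots> = measure_pmf.expectation M (\<lambda>x. measure_pmf.expectation (N x) f) + B"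
    using integrable_pmf_bounded[of M "\<lambda>x. measure_pmf.expectation (N x) f", OF EN(3)] by simp
  ultimately show ?thesis by linarith
qed

lemma expectation_replicate_Suc:
  fixes f :: "'a list \<Rightarrow> real"
  assumes "\<And>xs. xs \<in> set_pmf (replicate_pmf (Suc k) p) \<Longrightarrow> \<bar>f xs\<bar> \<le> B"
  shows "measure_pmf.expectation (replicate_pmf (Suc k) p) f =
    measure_pmf.expectation p (\<lambda>x. measure_pmf.expectation (replicate_pmf k p) (\<lambda>xs. f (x # xs)))"
proof -
  have eq: "replicate_pmf (Suc k) p = bind_pmf p (\<lambda>x. map_pmf (Cons x) (replicate_pmf k p))"
    by (simp add: map_pmf_def)
  show ?thesis
    unfolding eq by (subst expectation_bind_pmf[where B = B]) (use assms eq in auto)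
qed

lemma m_shuffle_le_1:
  assumes "n \<ge> 1"
  shows "m_shuffle n m \<sigma> \<le> 1"
proof (cases "m \<ge> 1 \<and> \<sigma> \<in> arrangements n")
  case True
  then have "m_shuffle n m \<sigma> \<le> (\<Sum>\<sigma>\<in>arrangements n. m_shuffle n m \<sigma>)"
    by (intro member_le_sum finite_arrangements) (auto simp: m_shuffle_nonneg)
  then show ?thesis using sum_m_shuffle[OF assms] True by simp
next
  case False
  then show ?thesis using assms by (cases "m = 0") (auto simp: m_shuffle_def power_0_left)
qed

lemma abs_m_shuffle_le_1: "n \<ge> 1 \<Longrightarrow> \<bar>m_shuffle n m \<sigma>\<bar> \<le> 1"
  using m_shuffle_le_1[of n m \<sigma>] m_shuffle_nonneg[of n m \<sigma>] by simp

lemma p_shuffle_eq_expectation: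
  assumes p: "set_pmf p \<subseteq> {1..}" and n: "n \<ge> 1"
  shows "p_shuffle n p \<sigma> = measure_pmf.expectation p (\<lambda>m. m_shuffle n m \<sigma>)"
proof -
  let ?f = "\<lambda>m. pmf p m * m_shuffle n m \<sigma>"
  have "Infinite_Set_Sum.abs_summable_on (pmf p) UNIV" by (rule pmf_abs_summable)
  then have s: "Infinite_Set_Sum.abs_summable_on ?f UNIV"
    by (rule Infinite_Set_Sum.abs_summable_on_comparison_test)
      (use abs_m_shuffle_le_1[OF n] in \<open>simp add: abs_mult mult_left_le\<close>)
  have "p_shuffle n p \<sigma> = infsum ?f UNIV"
    unfolding p_shuffle_def by (rule infsum_cong_neutral) (use p in \<open>auto simp: set_pmf_iff\<close>)
  also have "\<dots> = infsetsum ?f UNIV" by (rule infsetsum_infsum[OF s, symmetric])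
  also have "\<dots> = measure_pmf.expectation p (\<lambda>m. m_shuffle n m \<sigma>)"
    by (rule pmf_expectation_eq_infsetsum[symmetric])
  finally show ?thesis .
qed

text \<open>
  The law of \<open>X\<^sub>1 \<dots> X\<^sub>k\<close>, the number of packs of the single shuffle that is equivalent to \<open>k\<close>
  independent \<open>p\<close>-shuffles.
\<close>

definition pack_count :: "nat \<Rightarrow> nat pmf \<Rightarrow> nat pmf" where
  "pack_count k p = map_pmf prod_list (replicate_pmf k p)"

definition shuffle_mixture :: "nat \<Rightarrow> nat pmf \<Rightarrow> (nat \<Rightarrow> nat) \<Rightarrow> real" where
  "shuffle_mixture n N \<sigma> = measure_pmf.expectation N (\<lambda>m. m_shuffle n m \<sigma>)"

text \<open>
  Sorting by constant digits does nothing, so cutting into a single pack is the empty shuffle.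
\<close>

lemma m_shuffle_1:
  assumes \<sigma>: "\<sigma> \<in> arrangements n" and n: "n \<ge> 1"
  shows "m_shuffle n 1 \<sigma> = (if \<sigma> = id then 1 else 0)"
proof -
  have \<sigma>': "\<sigma> permutes {1..n}" using \<sigma> by (simp add: arrangements_def)
  have *: "stable_sort n d = id" if d: "d \<in> digit_strings n 1" for d
    by (rule stable_sort_eqI) (use d in \<open>auto simp: digit_strings_def permutes_id PiE_iff\<close>)
  have "{d \<in> digit_strings n 1. stable_sort n d = inv \<sigma>} = (if \<sigma> = id then digit_strings n 1 else {})"
    using * permutes_inv_inv[OF \<sigma>'] by (auto simp del: One_nat_def)
  then show ?thesis
    using m_shuffle_eq_card[OF \<sigma> n, of 1] card_digit_strings[of n 1] by simp
qed

text \<open>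
  Convolution is bilinear, so the semigroup law for fixed numbers of packs passes to mixtures with
  independent numbers of packs.
\<close>

lemma convolution_power_eq_mixture:
  assumes p: "set_pmf p \<subseteq> {1..}" and n: "n \<ge> 1" and \<sigma>: "\<sigma> \<in> arrangements n"
  shows "convolution_power n (p_shuffle n p) k \<sigma> = shuffle_mixture n (pack_count k p) \<sigma>"
  using \<sigma>
proof (induction k arbitrary: \<sigma>)
  case 0
  then show ?case by (simp add: shuffle_mixture_def pack_count_def m_shuffle_1[OF 0 n, simplified])
next
  case (Suc k)
  let ?R = "replicate_pmf k p" and ?E = "measure_pmf.expectation"
  let ?q = "\<lambda>x xs \<tau>. m_shuffle n (prod_list xs) \<tau> * m_shuffle n x (inv \<tau> \<circ> \<sigma>)"
  have q: "\<bar>?q x xs \<tau>\<bar> \<le> 1" for x xs \<tau>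
    using mult_mono[OF abs_m_shuffle_le_1[OF n] abs_m_shuffle_le_1[OF n]] by (simp add: abs_mult)
  have iq: "integrable ?R (\<lambda>xs. ?q x xs \<tau>)" for x \<tau>
    by (rule integrable_pmf_bounded[OF q])
  have "convolution_power n (p_shuffle n p) (Suc k) \<sigma> =
      (\<Sum>\<tau>\<in>arrangements n. ?E ?R (\<lambda>xs. m_shuffle n (prod_list xs) \<tau>) * ?E p (\<lambda>x. m_shuffle n x (inv \<tau> \<circ> \<sigma>)))"
    by (simp add: convolution_def Suc.IH p_shuffle_eq_expectation[OF p n] shuffle_mixture_def pack_count_def)
  also have "\<dots> = (\<Sum>\<tau>\<in>arrangements n. ?E p (\<lambda>x. ?E ?R (\<lambda>xs. ?q x xs \<tau>)))"
    by simp
  also have "\<dots> = ?E p (\<lambda>x. \<Sum>\<tau>\<in>arrangements n. ?E ?R (\<lambda>xs. ?q x xs \<tau>))"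
    by (rule Bochner_Integration.integral_sum[symmetric])
      (rule integrable_pmf_bounded[where B = 1], rule abs_expectation_le, rule q)
  also have "\<dots> = ?E p (\<lambda>x. ?E ?R (\<lambda>xs. m_shuffle n (prod_list (x # xs)) \<sigma>))"
  proof -
    have "(\<Sum>\<tau>\<in>arrangements n. ?E ?R (\<lambda>xs. ?q x xs \<tau>)) =
        ?E ?R (\<lambda>xs. m_shuffle n (prod_list (x # xs)) \<sigma>)" for x
    proof -
      have "(\<Sum>\<tau>\<in>arrangements n. ?E ?R (\<lambda>xs. ?q x xs \<tau>)) = ?E ?R (\<lambda>xs. \<Sum>\<tau>\<in>arrangements n. ?q x xs \<tau>)"
        by (rule Bochner_Integration.integral_sum[symmetric]) (rule iq)
      also have "(\<lambda>xs. \<Sum>\<tau>\<in>arrangements n. ?q x xs \<tau>) = (\<lambda>xs. m_shuffle n (prod_list (x # xs)) \<sigma>)"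
        using convolution_m_shuffle[OF Suc.prems n] by (simp add: convolution_def mult.commute)
      finally show ?thesis .
    qed
    then show ?thesis by simp
  qed
  also have "\<dots> = ?E (replicate_pmf (Suc k) p) (\<lambda>xs. m_shuffle n (prod_list xs) \<sigma>)"
    by (rule expectation_replicate_Suc[symmetric]) (rule abs_m_shuffle_le_1[OF n])
  finally show ?case by (simp add: shuffle_mixture_def pack_count_def del: replicate_pmf.simps)
qed

lemma sum_uniform_mass:
  assumes "A \<subseteq> arrangements n"
  shows "(\<Sum>\<sigma>\<in>A. uniform_mass n \<sigma>) = real (card A) / fact n"
proof -
  have "(\<Sum>\<sigma>\<in>A. uniform_mass n \<sigma>) = (\<Sum>\<sigma>\<in>A. 1 / fact n)"
    by (rule sum.cong) (use assms in \<open>auto simp: uniform_mass_def card_arrangements\<close>)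
  then show ?thesis by simp
qed

lemma tv_dist_cong:
  assumes "\<And>\<sigma>. \<sigma> \<in> arrangements n \<Longrightarrow> \<mu> \<sigma> = \<mu>' \<sigma>"
  shows "tv_dist n \<mu> \<nu> = tv_dist n \<mu>' \<nu>"
  unfolding tv_dist_def
  by (intro SUP_cong refl arg_cong2[where f = "(-)"] sum.cong) (use assms in auto)

lemma tv_dist_leI:
  assumes "\<And>A. A \<subseteq> arrangements n \<Longrightarrow> (\<Sum>\<sigma>\<in>A. \<mu> \<sigma>) - (\<Sum>\<sigma>\<in>A. \<nu> \<sigma>) \<le> c"
  shows "tv_dist n \<mu> \<nu> \<le> c"
  unfolding tv_dist_def by (rule cSUP_least) (use assms in auto)

lemma le_tv_dist:
  assumes "A \<subseteq> arrangements n"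
  shows "(\<Sum>\<sigma>\<in>A. \<mu> \<sigma>) - (\<Sum>\<sigma>\<in>A. \<nu> \<sigma>) \<le> tv_dist n \<mu> \<nu>"
  unfolding tv_dist_def
  by (rule cSUP_upper) (use assms finite_arrangements in auto)

lemma tv_dist_nonneg: "tv_dist n \<mu> \<nu> \<ge> 0"
  using le_tv_dist[of "{}" n \<mu> \<nu>] by simp

lemma sum_shuffle_mixture:
  assumes "n \<ge> 1"
  shows "(\<Sum>\<sigma>\<in>A. shuffle_mixture n N \<sigma>) = measure_pmf.expectation N (\<lambda>m. \<Sum>\<sigma>\<in>A. m_shuffle n m \<sigma>)"
  unfolding shuffle_mixture_def
  by (rule Bochner_Integration.integral_sum[symmetric])
    (rule integrable_pmf_bounded[OF abs_m_shuffle_le_1[OF assms]])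

lemma sum_m_shuffle_le_1:
  assumes "n \<ge> 1" "m \<ge> 1" "A \<subseteq> arrangements n"
  shows "(\<Sum>\<sigma>\<in>A. m_shuffle n m \<sigma>) \<le> 1"
  using sum_mono2[OF finite_arrangements assms(3), of "m_shuffle n m"] sum_m_shuffle[OF assms(1,2)]
  by (simp add: m_shuffle_nonneg)

lemma abs_sum_m_shuffle_le_1:
  assumes "n \<ge> 1" "m \<ge> 1" "A \<subseteq> arrangements n"
  shows "\<bar>\<Sum>\<sigma>\<in>A. m_shuffle n m \<sigma>\<bar> \<le> 1"
  using sum_m_shuffle_le_1[OF assms] sum_nonneg[of A "m_shuffle n m"] by (simp add: m_shuffle_nonneg)

lemma integrable_indicator_pmf: "integrable (measure_pmf N) (indicat_real S)"
  by (rule integrable_pmf_bounded[where B = 1]) (simp add: indicator_def)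

text \<open>
  Conditioning on the number of packs: values below \<open>L\<close> cost at most their probability, since
  no discrepancy exceeds 1.
\<close>

lemma tv_dist_mixture_le:
  assumes n: "n \<ge> 1" and N: "set_pmf N \<subseteq> {1..}" and c: "c \<ge> 0"
    and bd: "\<And>m A. real m \<ge> L \<Longrightarrow> m \<ge> 1 \<Longrightarrow> A \<subseteq> arrangements n \<Longrightarrow>
      (\<Sum>\<sigma>\<in>A. m_shuffle n m \<sigma>) - (\<Sum>\<sigma>\<in>A. uniform_mass n \<sigma>) \<le> c"
  shows "tv_dist n (shuffle_mixture n N) (uniform_mass n) \<le> measure_pmf.prob N {m. real m < L} + c"
proof (rule tv_dist_leI)
  fix A assume A: "A \<subseteq> arrangements n"
  let ?u = "\<Sum>\<sigma>\<in>A. uniform_mass n \<sigma>"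
  have u: "?u \<ge> 0" by (simp add: sum_uniform_mass[OF A])
  have "(\<Sum>\<sigma>\<in>A. shuffle_mixture n N \<sigma>) \<le>
      measure_pmf.expectation N (\<lambda>m. ?u + c + indicat_real {m. real m < L} m)"
    unfolding sum_shuffle_mixture[OF n]
  proof (rule integral_mono_AE)
    show "integrable N (\<lambda>m. \<Sum>\<sigma>\<in>A. m_shuffle n m \<sigma>)"
      by (rule integrable_pmf_bounded[OF abs_sum_m_shuffle_le_1[OF n _ A]]) (use N in auto)
    show "AE m in N. (\<Sum>\<sigma>\<in>A. m_shuffle n m \<sigma>) \<le> ?u + c + indicat_real {m. real m < L} m"
      unfolding AE_measure_pmf_iff
    proof
      fix m assume "m \<in> set_pmf N"
      then have m: "m \<ge> 1" using N by auto
      show "(\<Sum>\<sigma>\<in>A. m_shuffle n m \<sigma>) \<le> ?u + c + indicat_real {m. real m < L} m"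
        using bd[OF _ m A] sum_m_shuffle_le_1[OF n m A] u c by (cases "real m < L") auto
    qed
  qed (intro Bochner_Integration.integrable_add Bochner_Integration.integrable_diff
      integrable_indicator_pmf measure_pmf.integrable_const)
  also have "\<dots> = ?u + c + measure_pmf.prob N {m. real m < L}"
    using integrable_indicator_pmf[of N "{m. real m < L}"] by simp
  finally show "(\<Sum>\<sigma>\<in>A. shuffle_mixture n N \<sigma>) - ?u \<le> measure_pmf.prob N {m. real m < L} + c" by simp
qed

text \<open>
  A single event that is likely for every \<open>m \<le> L\<close> remains likely for the mixture, up to the
  probability of more than \<open>L\<close> packs.
\<close>

lemma tv_dist_mixture_ge:
  assumes n: "n \<ge> 1" and N: "set_pmf N \<subseteq> {1..}" and A: "A \<subseteq> arrangements n" and c: "c \<ge> 0"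
    and bd: "\<And>m. real m \<le> L \<Longrightarrow> m \<ge> 1 \<Longrightarrow> (\<Sum>\<sigma>\<in>A. m_shuffle n m \<sigma>) \<ge> 1 - c"
  shows "tv_dist n (shuffle_mixture n N) (uniform_mass n) \<ge>
    1 - c - measure_pmf.prob N {m. real m > L} - (\<Sum>\<sigma>\<in>A. uniform_mass n \<sigma>)"
proof -
  have "measure_pmf.expectation N (\<lambda>m. 1 - c - indicat_real {m. real m > L} m) \<le>
      (\<Sum>\<sigma>\<in>A. shuffle_mixture n N \<sigma>)"
    unfolding sum_shuffle_mixture[OF n]
  proof (rule integral_mono_AE)
    show "integrable N (\<lambda>m. \<Sum>\<sigma>\<in>A. m_shuffle n m \<sigma>)"
      by (rule integrable_pmf_bounded[OF abs_sum_m_shuffle_le_1[OF n _ A]]) (use N in auto)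
    show "AE m in N. 1 - c - indicat_real {m. real m > L} m \<le> (\<Sum>\<sigma>\<in>A. m_shuffle n m \<sigma>)"
      unfolding AE_measure_pmf_iff
    proof
      fix m assume "m \<in> set_pmf N"
      then have m: "m \<ge> 1" using N by auto
      show "1 - c - indicat_real {m. real m > L} m \<le> (\<Sum>\<sigma>\<in>A. m_shuffle n m \<sigma>)"
        using bd[OF _ m] sum_nonneg[of A "m_shuffle n m"] c m_shuffle_nonneg
        by (cases "real m > L") auto
    qed
  qed (intro Bochner_Integration.integrable_add Bochner_Integration.integrable_diff
      integrable_indicator_pmf measure_pmf.integrable_const)
  moreover have "measure_pmf.expectation N (\<lambda>m. 1 - c - indicat_real {m. real m > L} m) =
      1 - c - measure_pmf.prob N {m. real m > L}"
    using integrable_indicator_pmf[of N "{m. real m > L}"] by simp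
  ultimately show ?thesis
    using le_tv_dist[OF A, of "shuffle_mixture n N" "uniform_mass n"] by linarith
qed

lemma tv_dist_mixture_le_1:
  assumes n: "n \<ge> 1" and N: "set_pmf N \<subseteq> {1..}"
  shows "tv_dist n (shuffle_mixture n N) (uniform_mass n) \<le> 1"
proof (rule tv_dist_leI)
  fix A assume A: "A \<subseteq> arrangements n"
  have "(\<Sum>\<sigma>\<in>A. shuffle_mixture n N \<sigma>) \<le> 1"
    unfolding sum_shuffle_mixture[OF n]
    by (rule order_trans[OF abs_ge_self], rule abs_expectation_le, rule abs_sum_m_shuffle_le_1[OF n _ A])
      (use N in auto)
  then show "(\<Sum>\<sigma>\<in>A. shuffle_mixture n N \<sigma>) - (\<Sum>\<sigma>\<in>A. uniform_mass n \<sigma>) \<le> 1"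
    by (simp add: sum_uniform_mass[OF A])
       (smt (verit) divide_nonneg_pos fact_gt_zero of_nat_0_le_iff)
qed

lemma set_pack_count:
  assumes "set_pmf p \<subseteq> {1..}"
  shows "set_pmf (pack_count k p) \<subseteq> {1..}"
proof -
  have "prod_list xs \<ge> 1" if "xs \<in> lists (set_pmf p)" for xs
    using that by (induction rule: lists.induct) (use assms in auto)
  then show ?thesis by (auto simp: pack_count_def set_replicate_pmf)
qed

section \<open>Rising sequences of a uniform arrangement\<close>

text \<open>
  The number of rising sequences has mean \<open>(n + 1) / 2\<close> under the uniform distribution.
\<close>

definition rise_excess :: "nat \<Rightarrow> (nat \<Rightarrow> nat) \<Rightarrow> real" where
  "rise_excess n \<sigma> = real (rising_sequences n \<sigma>) - (real n + 1) / 2"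

definition descent_sign :: "(nat \<Rightarrow> nat) \<Rightarrow> nat \<Rightarrow> real" where
  "descent_sign \<sigma> i = (if inv \<sigma> (Suc i) < inv \<sigma> i then 1 / 2 else - 1 / 2)"

lemma rise_excess_eq_sum:
  assumes "n \<ge> 1"
  shows "rise_excess n \<sigma> = (\<Sum>i\<in>{1..<n}. descent_sign \<sigma> i)"
proof -
  have "(\<Sum>i\<in>{1..<n}. descent_sign \<sigma> i) =
      (\<Sum>i\<in>{1..<n}. (if inv \<sigma> (Suc i) < inv \<sigma> i then 1 else 0) - 1 / 2)"
    by (rule sum.cong) (auto simp: descent_sign_def)
  also have "\<dots> = real (card (descents n (inv \<sigma>))) - (real n - 1) / 2"
    unfolding sum_subtractf descents_def using assms
    by (simp add: sum.If_cases Int_def of_nat_diff)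
  finally show ?thesis
    by (simp add: rise_excess_def rising_sequences_eq field_simps)
qed

text \<open>
  Exchanging the cards \<open>i\<close> and \<open>i + 1\<close> is an involution that reverses the sign at \<open>i\<close> and affects
  only the signs at \<open>i - 1\<close>, \<open>i\<close> and \<open>i + 1\<close>. Signs that are not adjacent are therefore
  uncorrelated.
\<close>

lemma sum_descent_sign_product_eq_0:
  assumes i: "i \<in> {1..<n}" and far: "Suc i < j \<or> Suc j < i"
  shows "(\<Sum>\<sigma>\<in>arrangements n. descent_sign \<sigma> i * descent_sign \<sigma> j) = 0"
proof -
  let ?t = "Transposition.transpose i (Suc i)"
  have t: "?t permutes {1..n}" using i by (intro permutes_swap_id) auto
  have inv_t: "inv (?t \<circ> \<sigma>) = inv \<sigma> \<circ> ?t" if "\<sigma> \<in> arrangements n" for \<sigma>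
    using that permutes_bij[OF t] by (simp add: arrangements_def o_inv_distrib permutes_bij)
  have bij: "bij_betw (\<lambda>\<sigma>. ?t \<circ> \<sigma>) (arrangements n) (arrangements n)"
    by (rule bij_betw_byWitness[where f' = "\<lambda>\<sigma>. ?t \<circ> \<sigma>"])
      (use permutes_compose[OF _ t] in \<open>auto simp: arrangements_def fun_eq_iff\<close>)
  have flip: "descent_sign (?t \<circ> \<sigma>) i * descent_sign (?t \<circ> \<sigma>) j =
      - (descent_sign \<sigma> i * descent_sign \<sigma> j)" if \<sigma>: "\<sigma> \<in> arrangements n" for \<sigma>
  proof -
    have "inv \<sigma> (Suc i) \<noteq> inv \<sigma> i"
      using permutes_inj[of "inv \<sigma>"] inv_arrangements[OF \<sigma>] unfolding arrangements_def
      by (metis injD mem_Collect_eq n_not_Suc_n)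
    then have "descent_sign (?t \<circ> \<sigma>) i = - descent_sign \<sigma> i"
      unfolding descent_sign_def inv_t[OF \<sigma>] by auto
    moreover have "descent_sign (?t \<circ> \<sigma>) j = descent_sign \<sigma> j"
      unfolding descent_sign_def inv_t[OF \<sigma>] using far by (auto simp: Transposition.transpose_def)
    ultimately show ?thesis by simp
  qed
  have "(\<Sum>\<sigma>\<in>arrangements n. descent_sign \<sigma> i * descent_sign \<sigma> j) =
      (\<Sum>\<sigma>\<in>arrangements n. descent_sign (?t \<circ> \<sigma>) i * descent_sign (?t \<circ> \<sigma>) j)"
    by (rule sum.reindex_bij_betw[OF bij, symmetric])
  also have "\<dots> = - (\<Sum>\<sigma>\<in>arrangements n. descent_sign \<sigma> i * descent_sign \<sigma> j)"
    unfolding sum_negf[symmetric] by (rule sum.cong) (simp_all only: flip)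
  finally show ?thesis by simp
qed

text \<open>
  Only the at most \<open>3 (n - 1)\<close> covariances of equal or adjacent signs survive, and each is at most
  \<open>1 / 4\<close>. For \<open>n \<ge> 2\<close> the variance is in fact \<open>(n + 1) / 12\<close>, but only its order matters.
\<close>

lemma sum_rise_excess_sq_le:
  assumes n: "n \<ge> 1"
  shows "(\<Sum>\<sigma>\<in>arrangements n. (rise_excess n \<sigma>)\<^sup>2) \<le> real n * fact n"
proof -
  let ?C = "\<lambda>i j. \<Sum>\<sigma>\<in>arrangements n. descent_sign \<sigma> i * descent_sign \<sigma> j"
  have bound: "?C i j \<le> fact n / 4" for i j
  proof -
    have "?C i j \<le> (\<Sum>\<sigma>\<in>arrangements n. 1 / 4)"
      by (rule sum_mono) (auto simp: descent_sign_def)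
    then show ?thesis by (simp add: card_arrangements)
  qed
  have "(\<Sum>\<sigma>\<in>arrangements n. (rise_excess n \<sigma>)\<^sup>2) =
      (\<Sum>\<sigma>\<in>arrangements n. \<Sum>i\<in>{1..<n}. \<Sum>j\<in>{1..<n}. descent_sign \<sigma> i * descent_sign \<sigma> j)"
    by (simp only: rise_excess_eq_sum[OF n] power2_eq_square sum_product)
  also have "\<dots> = (\<Sum>i\<in>{1..<n}. \<Sum>j\<in>{1..<n}. ?C i j)"
    by (subst sum.swap, rule sum.cong[OF refl], rule sum.swap)
  also have "\<dots> \<le> (\<Sum>i\<in>{1..<n}. 3 * (fact n / 4))"
  proof (rule sum_mono)
    fix i assume i: "i \<in> {1..<n}"
    have "(\<Sum>j\<in>{1..<n}. ?C i j) = (\<Sum>j\<in>{1..<n} \<inter> {i - 1..Suc i}. ?C i j)"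
    proof (rule sum.mono_neutral_right, simp_all only: finite_atLeastLessThan Int_lower1, rule ballI)
      fix j assume j: "j \<in> {1..<n} - {1..<n} \<inter> {i - 1..Suc i}"
      then have "Suc i < j \<or> Suc j < i" by auto
      then show "?C i j = 0" by (rule sum_descent_sign_product_eq_0[OF i])
    qed
    also have "\<dots> \<le> (\<Sum>j\<in>{1..<n} \<inter> {i - 1..Suc i}. fact n / 4)"
      by (rule sum_mono) (rule bound)
    also have "\<dots> = real (card ({1..<n} \<inter> {i - 1..Suc i})) * (fact n / 4)" by simp
    also have "\<dots> \<le> 3 * (fact n / 4)"
    proof (rule mult_right_mono)
      have "card ({1..<n} \<inter> {i - 1..Suc i}) \<le> card {i - 1..Suc i}" by (rule card_mono) auto
      also have "\<dots> \<le> 3" using i by auto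
      finally show "real (card ({1..<n} \<inter> {i - 1..Suc i})) \<le> 3" by linarith
    qed simp
    finally show "(\<Sum>j\<in>{1..<n}. ?C i j) \<le> 3 * (fact n / 4)" .
  qed
  also have "\<dots> = real (n - 1) * (3 / 4) * fact n" by simp
  also have "\<dots> \<le> real n * fact n"
    by (rule mult_right_mono) (use n in \<open>auto simp: of_nat_diff field_simps\<close>)
  finally show ?thesis .
qed

lemma sum_abs_rise_excess_le:
  assumes n: "n \<ge> 1"
  shows "(\<Sum>\<sigma>\<in>arrangements n. \<bar>rise_excess n \<sigma>\<bar>) \<le> sqrt (real n) * fact n"
proof -
  have pos: "sqrt (real n) > 0" using n by simp
  have "(\<Sum>\<sigma>\<in>arrangements n. \<bar>rise_excess n \<sigma>\<bar>) \<le>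
      (\<Sum>\<sigma>\<in>arrangements n. (rise_excess n \<sigma>)\<^sup>2 / (2 * sqrt (real n)) + sqrt (real n) / 2)"
  proof (rule sum_mono)
    fix \<sigma>
    \<comment> \<open>The weight \<open>sqrt n\<close> balances both terms of the arithmetic-geometric mean inequality,
        as \<open>h\<^sup>2\<close> has mean of order \<open>n\<close>.\<close>
    have "0 \<le> (\<bar>rise_excess n \<sigma>\<bar> - sqrt (real n))\<^sup>2" by simp
    then have "2 * sqrt (real n) * \<bar>rise_excess n \<sigma>\<bar> \<le> (rise_excess n \<sigma>)\<^sup>2 + sqrt (real n) * sqrt (real n)"
      by (simp add: power2_diff power2_eq_square algebra_simps)
    then show "\<bar>rise_excess n \<sigma>\<bar> \<le> (rise_excess n \<sigma>)\<^sup>2 / (2 * sqrt (real n)) + sqrt (real n) / 2"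
      using pos by (simp add: field_simps)
  qed
  also have "\<dots> = (\<Sum>\<sigma>\<in>arrangements n. (rise_excess n \<sigma>)\<^sup>2) / (2 * sqrt (real n)) + sqrt (real n) / 2 * fact n"
    by (simp add: sum.distrib sum_divide_distrib card_arrangements)
  also have "\<dots> \<le> real n * fact n / (2 * sqrt (real n)) + sqrt (real n) / 2 * fact n"
    using sum_rise_excess_sq_le[OF n] pos by (intro add_right_mono divide_right_mono) auto
  also have "\<dots> = sqrt (real n) * fact n"
  proof -
    have "real n / (2 * sqrt (real n)) = sqrt (real n) / 2"
      using pos by (simp add: field_simps)
    then have "real n * fact n / (2 * sqrt (real n)) = sqrt (real n) / 2 * fact n"
      by (metis times_divide_eq_left mult.commute)
    then show ?thesis by linarith
  qed
  finally show ?thesis .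
qed

lemma uniform_low_rise_excess_le:
  assumes n: "n \<ge> 1" and b: "b > 0"
  shows "(\<Sum>\<sigma>\<in>{\<sigma> \<in> arrangements n. rise_excess n \<sigma> \<le> - b}. uniform_mass n \<sigma>) \<le> real n / b\<^sup>2"
proof -
  let ?A = "{\<sigma> \<in> arrangements n. rise_excess n \<sigma> \<le> - b}"
  have "real (card ?A) * b\<^sup>2 = (\<Sum>\<sigma>\<in>?A. b\<^sup>2)" by simp
  also have "\<dots> \<le> (\<Sum>\<sigma>\<in>?A. (rise_excess n \<sigma>)\<^sup>2)"
  proof (rule sum_mono)
    fix \<sigma> assume "\<sigma> \<in> ?A"
    then have "b \<le> - rise_excess n \<sigma>" by simp
    then show "b\<^sup>2 \<le> (rise_excess n \<sigma>)\<^sup>2" using power_mono[of b "- rise_excess n \<sigma>" 2] b by simp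
  qed
  also have "\<dots> \<le> (\<Sum>\<sigma>\<in>arrangements n. (rise_excess n \<sigma>)\<^sup>2)"
    by (rule sum_mono2[OF finite_arrangements]) auto
  also have "\<dots> \<le> real n * fact n" by (rule sum_rise_excess_sq_le[OF n])
  finally have "real (card ?A) * b\<^sup>2 \<le> real n * fact n" .
  moreover have "(\<Sum>\<sigma>\<in>?A. uniform_mass n \<sigma>) = real (card ?A) / fact n"
    by (rule sum_uniform_mass) auto
  ultimately show ?thesis using b
    by (simp only:) (simp add: pos_le_divide_eq pos_divide_le_eq mult.commute mult.left_commute)
qed

section \<open>The likelihood ratio of a single shuffle\<close>

text \<open>
  With \<open>r\<close> rising sequences, the factor \<open>n + m - r - i\<close> of the falling factorial is
  \<open>m + centred n i - (r - (n + 1) / 2)\<close>. Splitting it this way separates the deviation of \<open>r\<close>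
  from numbers that sum to 0.
\<close>

definition centred :: "nat \<Rightarrow> nat \<Rightarrow> real" where
  "centred n i = (real n - 1) / 2 - real i"

lemma sum_centred: "(\<Sum>i<n. centred n i) = 0"
proof -
  have "(\<Sum>i<k. real i) = real k * (real k - 1) / 2" for k
    by (induction k) (simp_all add: field_simps)
  then show ?thesis by (simp add: centred_def sum_subtractf)
qed

lemma sum_centred_sq: "(\<Sum>i<n. (centred n i)\<^sup>2) = real n * ((real n)\<^sup>2 - 1) / 12"
proof -
  have 1: "(\<Sum>i<k. real i) = real k * (real k - 1) / 2" for k
    by (induction k) (simp_all add: field_simps)
  have 2: "(\<Sum>i<k. (real i)\<^sup>2) = real k * (real k - 1) * (2 * real k - 1) / 6" for k
    by (induction k) (simp_all add: field_simps power2_eq_square)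
  have "(\<Sum>i<n. (centred n i)\<^sup>2) = (\<Sum>i<n. ((real n - 1) / 2)\<^sup>2 - (real n - 1) * real i + (real i)\<^sup>2)"
    by (rule sum.cong) (simp_all add: centred_def power2_eq_square field_simps)
  also have "\<dots> = real n * ((real n - 1) / 2)\<^sup>2 - (real n - 1) * (\<Sum>i<n. real i) + (\<Sum>i<n. (real i)\<^sup>2)"
    by (simp add: sum.distrib sum_subtractf sum_distrib_left)
  also have "\<dots> = real n * ((real n)\<^sup>2 - 1) / 12"
    unfolding 1 2 by (simp add: field_simps power2_eq_square)
  finally show ?thesis .
qed

lemma rising_sequences_le: "n \<ge> 1 \<Longrightarrow> rising_sequences n \<sigma> \<le> n"
  using card_mono[of "{1..<n}" "descents n (inv \<sigma>)"] unfolding rising_sequences_eq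
  by (auto simp: descents_def subset_iff simp del: One_nat_def)

lemma m_shuffle_eq_prod:
  assumes \<sigma>: "\<sigma> \<in> arrangements n" and n: "n \<ge> 1" and m: "m \<ge> 1"
  shows "fact n * m_shuffle n m \<sigma> = (\<Prod>i<n. 1 + (centred n i - rise_excess n \<sigma>) / real m)"
proof -
  let ?N = "n + m - rising_sequences n \<sigma>"
  have N: "real ?N = real n + real m - real (rising_sequences n \<sigma>)"
    using rising_sequences_le[OF n, of \<sigma>] by linarith
  have "fact n * m_shuffle n m \<sigma> = fact n * (real ?N gchoose n) / real m ^ n"
    using \<sigma> by (simp add: m_shuffle_def binomial_gbinomial)
  also have "fact n * (real ?N gchoose n) = (\<Prod>i<n. real ?N - real i)"
    by (simp add: gbinomial_prod_rev atLeast0LessThan)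
  also have "\<dots> / real m ^ n = (\<Prod>i<n. (real ?N - real i) / real m)"
    by (simp add: prod_dividef)
  also have "\<dots> = (\<Prod>i<n. 1 + (centred n i - rise_excess n \<sigma>) / real m)"
    by (rule prod.cong) (use m N in \<open>auto simp: centred_def rise_excess_def field_simps\<close>)
  finally show ?thesis .
qed

text \<open>
  The estimate \<open>ln (1 + x) \<ge> x - 2 x\<^sup>2\<close> for \<open>\<bar>x\<bar> \<le> 1 / 2\<close> applies to every factor because
  \<open>m \<ge> 2 n\<close>. The linear terms add up to \<open>- n h / m\<close>, since the centred numbers cancel, and every
  quadratic term is at most \<open>2 (n / m)\<^sup>2\<close>.
\<close>

lemma m_shuffle_likelihood_ge:
  assumes \<sigma>: "\<sigma> \<in> arrangements n" and n: "n \<ge> 1" and m: "2 * n \<le> m"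
  shows "1 - real n * \<bar>rise_excess n \<sigma>\<bar> / real m - 2 * real n ^ 3 / (real m)\<^sup>2 \<le> fact n * m_shuffle n m \<sigma>"
proof -
  define x where "x i = (centred n i - rise_excess n \<sigma>) / real m" for i
  have m0: "real m > 0" "m \<ge> 1" using n m by auto
  have xle: "\<bar>x i\<bar> \<le> real n / real m" if "i < n" for i
  proof -
    have "centred n i - rise_excess n \<sigma> = real n - real (rising_sequences n \<sigma>) - real i"
      by (simp add: centred_def rise_excess_def field_simps)
    then have "\<bar>centred n i - rise_excess n \<sigma>\<bar> \<le> real n"
      using rising_sequences_le[OF n, of \<sigma>] that by linarith
    then show ?thesis using m0 by (simp add: x_def divide_right_mono)
  qed
  have half: "real n / real m \<le> 1 / 2" using m m0 by (simp add: field_simps)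
  have ln_ge: "x i - 2 * (real n / real m)\<^sup>2 \<le> ln (1 + x i)" and pos: "1 + x i > 0" if "i < n" for i
  proof -
    have "\<bar>x i\<bar> \<le> 1 / 2" using xle[OF that] half by linarith
    moreover have "(x i)\<^sup>2 \<le> (real n / real m)\<^sup>2"
      using xle[OF that] by (metis abs_ge_zero power2_abs power_mono)
    ultimately show "x i - 2 * (real n / real m)\<^sup>2 \<le> ln (1 + x i)" "1 + x i > 0"
      using abs_ln_one_plus_x_minus_x_bound[of "x i"] by (auto simp: abs_le_iff)
  qed
  have "(\<Sum>i<n. x i) = - real n * rise_excess n \<sigma> / real m"
    unfolding x_def sum_divide_distrib[symmetric] by (simp add: sum_subtractf sum_centred)
  then have sum: "(\<Sum>i<n. x i - 2 * (real n / real m)\<^sup>2) =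
      - real n * rise_excess n \<sigma> / real m - 2 * real n ^ 3 / (real m)\<^sup>2"
    by (simp add: sum_subtractf power2_eq_square power3_eq_cube)
  have "- real n * rise_excess n \<sigma> / real m \<ge> - (real n * \<bar>rise_excess n \<sigma>\<bar> / real m)"
    using m0 by (simp add: field_simps abs_le_iff mult_left_mono)
  then have "1 - real n * \<bar>rise_excess n \<sigma>\<bar> / real m - 2 * real n ^ 3 / (real m)\<^sup>2 \<le>
      1 + (\<Sum>i<n. x i - 2 * (real n / real m)\<^sup>2)"
    unfolding sum by linarith
  also have "\<dots> \<le> exp (\<Sum>i<n. x i - 2 * (real n / real m)\<^sup>2)" by (rule exp_ge_add_one_self)
  also have "\<dots> \<le> exp (\<Sum>i<n. ln (1 + x i))" using ln_ge by (auto intro!: sum_mono)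
  also have "\<dots> = (\<Prod>i<n. 1 + x i)" using pos by (simp add: exp_sum)
  also have "\<dots> = fact n * m_shuffle n m \<sigma>"
    unfolding x_def by (rule m_shuffle_eq_prod[OF \<sigma> n m0(2), symmetric])
  finally show ?thesis .
qed

text \<open>
  Passing to the complement of \<open>A\<close> turns the lower bound for the density into an upper bound for
  the excess mass on \<open>A\<close>. The mean of \<open>\<bar>h\<bar>\<close> is at most \<open>sqrt n\<close>.
\<close>

lemma m_shuffle_near_uniform:
  assumes n: "n \<ge> 1" and m: "2 * n \<le> m" and A: "A \<subseteq> arrangements n"
  shows "(\<Sum>\<sigma>\<in>A. m_shuffle n m \<sigma>) - (\<Sum>\<sigma>\<in>A. uniform_mass n \<sigma>) \<le>
    real n * sqrt (real n) / real m + 2 * real n ^ 3 / (real m)\<^sup>2"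
proof -
  let ?B = "arrangements n - A" and ?c = "2 * real n ^ 3 / (real m)\<^sup>2"
  have m1: "m \<ge> 1" using n m by simp
  have "(\<Sum>\<sigma>\<in>arrangements n. uniform_mass n \<sigma>) = 1"
    by (simp add: sum_uniform_mass card_arrangements)
  then have "(\<Sum>\<sigma>\<in>A. m_shuffle n m \<sigma>) - (\<Sum>\<sigma>\<in>A. uniform_mass n \<sigma>) =
      (\<Sum>\<sigma>\<in>?B. uniform_mass n \<sigma>) - (\<Sum>\<sigma>\<in>?B. m_shuffle n m \<sigma>)"
    using sum_m_shuffle[OF n m1] sum.subset_diff[OF A finite_arrangements, of "m_shuffle n m"]
      sum.subset_diff[OF A finite_arrangements, of "uniform_mass n"] by linarith
  also have "\<dots> = (\<Sum>\<sigma>\<in>?B. uniform_mass n \<sigma> - m_shuffle n m \<sigma>)" by (simp add: sum_subtractf)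
  also have "\<dots> \<le> (\<Sum>\<sigma>\<in>?B. (real n / real m * \<bar>rise_excess n \<sigma>\<bar> + ?c) / fact n)"
  proof (rule sum_mono)
    fix \<sigma> assume "\<sigma> \<in> ?B"
    then have \<sigma>: "\<sigma> \<in> arrangements n" by simp
    show "uniform_mass n \<sigma> - m_shuffle n m \<sigma> \<le> (real n / real m * \<bar>rise_excess n \<sigma>\<bar> + ?c) / fact n"
      using m_shuffle_likelihood_ge[OF \<sigma> n m] \<sigma>
      by (simp add: uniform_mass_def card_arrangements le_divide_eq) (simp add: algebra_simps)
  qed
  also have "\<dots> \<le> (\<Sum>\<sigma>\<in>arrangements n. (real n / real m * \<bar>rise_excess n \<sigma>\<bar> + ?c) / fact n)"
    by (rule sum_mono2[OF finite_arrangements]) auto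
  also have "\<dots> = real n / real m * (\<Sum>\<sigma>\<in>arrangements n. \<bar>rise_excess n \<sigma>\<bar>) / fact n + ?c"
    by (simp add: sum.distrib card_arrangements add_divide_distrib
        flip: sum_divide_distrib sum_distrib_left)
  also have "\<dots> \<le> real n / real m * (sqrt (real n) * fact n) / fact n + ?c"
    by (intro add_right_mono divide_right_mono mult_left_mono sum_abs_rise_excess_le n) auto
  finally show ?thesis by simp
qed

text \<open>
  The centred numbers are symmetric, so pairing factor \<open>i\<close> with factor \<open>n - 1 - i\<close> gives
  \<open>((m - h)\<^sup>2 - c\<^sub>i\<^sup>2) / m\<^sup>2\<close>, which is bounded by an exponential through \<open>1 + x \<le> exp x\<close> without any
  restriction on the size of \<open>m\<close>. Taking each pair twice yields the square of the density. The
  condition on the rising sequences makes all factors positive.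
\<close>

lemma m_shuffle_likelihood_le:
  assumes \<sigma>: "\<sigma> \<in> arrangements n" and n: "n \<ge> 1" and m: "m \<ge> 1"
    and r: "rising_sequences n \<sigma> \<le> m"
  shows "fact n * m_shuffle n m \<sigma> \<le>
    exp (- (real n * rise_excess n \<sigma> / real m) -
      real n * ((real n)\<^sup>2 - 1) / (24 * (real m - rise_excess n \<sigma>)\<^sup>2))"
    and "real m - rise_excess n \<sigma> > 0"
proof -
  let ?h = "rise_excess n \<sigma>"
  define y where "y i = 1 + (centred n i - ?h) / real m" for i
  define w where "w = real m - ?h"
  have m0: "real m > 0" using m by simp
  have ypos: "y i > 0" if "i < n" for i
  proof -
    have "y i = (real m + real n - real (rising_sequences n \<sigma>) - real i) / real m"
      unfolding y_def using m0 by (simp add: centred_def rise_excess_def field_simps)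
    then show ?thesis using that r m0 by simp
  qed
  have sym: "centred n (n - Suc i) = - centred n i" if "i < n" for i
    using that by (simp add: centred_def of_nat_diff field_simps)
  show w0: "w > 0"
  proof -
    have "y 0 + y (n - Suc 0) = 2 * w / real m"
      using sym[of 0] n m0 unfolding y_def w_def by (simp add: field_simps)
    moreover have "y 0 + y (n - Suc 0) > 0" using ypos[of 0] ypos[of "n - Suc 0"] n by simp
    ultimately show ?thesis using m0 by (simp add: zero_less_divide_iff)
  qed
  have pair: "y i * y (n - Suc i) \<le> exp (- 2 * ?h / real m - (centred n i)\<^sup>2 / w\<^sup>2)" if i: "i < n" for i
  proof -
    have prod_eq: "y i * y (n - Suc i) = (w / real m)\<^sup>2 * (1 - (centred n i)\<^sup>2 / w\<^sup>2)"
    proof -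
      have y: "y i = (w + centred n i) / real m" "y (n - Suc i) = (w - centred n i) / real m"
        unfolding y_def sym[OF i] using m0 by (simp_all add: w_def field_simps)
      show ?thesis unfolding y using m0 w0 by (simp add: field_simps power2_eq_square)
    qed
    note prod_eq
    also have "(w / real m)\<^sup>2 * (1 - (centred n i)\<^sup>2 / w\<^sup>2) \<le> (exp (- ?h / real m))\<^sup>2 * exp (- (centred n i)\<^sup>2 / w\<^sup>2)"
    proof (rule mult_mono)
      have "w / real m = 1 + (- ?h / real m)" using m0 by (simp add: w_def field_simps)
      also have "\<dots> \<le> exp (- ?h / real m)" by (rule exp_ge_add_one_self)
      finally show "(w / real m)\<^sup>2 \<le> (exp (- ?h / real m))\<^sup>2" using w0 m0 by (intro power_mono) auto
      show "1 - (centred n i)\<^sup>2 / w\<^sup>2 \<le> exp (- (centred n i)\<^sup>2 / w\<^sup>2)"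
        using exp_ge_add_one_self[of "- (centred n i)\<^sup>2 / w\<^sup>2"] by simp
      show "0 \<le> 1 - (centred n i)\<^sup>2 / w\<^sup>2"
      proof -
        have "0 < (w / real m)\<^sup>2 * (1 - (centred n i)\<^sup>2 / w\<^sup>2)"
          unfolding prod_eq[symmetric] using ypos[OF i] ypos[of "n - Suc i"] i by simp
        then show ?thesis using w0 m0 by (simp add: zero_less_mult_iff)
      qed
    qed simp
    also have "\<dots> = exp (- 2 * ?h / real m - (centred n i)\<^sup>2 / w\<^sup>2)"
      by (simp add: power2_eq_square flip: exp_add)
    finally show ?thesis .
  qed
  have "(fact n * m_shuffle n m \<sigma>)\<^sup>2 = (\<Prod>i<n. y i) * (\<Prod>i<n. y (n - Suc i))"
    using m_shuffle_eq_prod[OF \<sigma> n m] unfolding y_def[symmetric]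
    by (simp add: power2_eq_square prod.nat_diff_reindex)
  also have "\<dots> = (\<Prod>i<n. y i * y (n - Suc i))" by (simp add: prod.distrib)
  also have "\<dots> \<le> (\<Prod>i<n. exp (- 2 * ?h / real m - (centred n i)\<^sup>2 / w\<^sup>2))"
    by (rule prod_mono) (use pair ypos in \<open>auto intro!: mult_nonneg_nonneg less_imp_le\<close>)
  also have "\<dots> = exp (\<Sum>i<n. - 2 * ?h / real m - (centred n i)\<^sup>2 / w\<^sup>2)" by (simp add: exp_sum)
  also have "(\<Sum>i<n. - 2 * ?h / real m - (centred n i)\<^sup>2 / w\<^sup>2) =
      2 * (- (real n * ?h / real m) - real n * ((real n)\<^sup>2 - 1) / (24 * w\<^sup>2))"
    unfolding sum_subtractf sum_divide_distrib[symmetric] sum_centred_sq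
    using w0 m0 by (simp add: divide_simps)
  also have "exp \<dots> = (exp (- (real n * ?h / real m) - real n * ((real n)\<^sup>2 - 1) / (24 * w\<^sup>2)))\<^sup>2"
    by (rule exp_double)
  finally show "fact n * m_shuffle n m \<sigma> \<le>
      exp (- (real n * ?h / real m) - real n * ((real n)\<^sup>2 - 1) / (24 * w\<^sup>2))"
    by (rule power2_le_imp_le) simp
qed

text \<open>
  Where \<open>h > - b\<close> the linear term of the exponent is at most \<open>n b / m\<close>. The second-order term is at
  least twice as large because \<open>m b\<close> is small compared with \<open>n\<^sup>2\<close>, so the exponent is at most
  \<open>- n b / m\<close>. The same \<open>L\<close> and \<open>b\<close> serve all \<open>m \<le> L\<close>.
\<close>

lemma m_shuffle_low_rise_excess_ge:
  assumes n: "n \<ge> 1" and m: "m \<ge> 1" and b: "b > 0" "4 * b \<le> real n"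
    and mL: "real m \<le> L" and L: "192 * L * b \<le> (real n)\<^sup>2 - 1"
  shows "(\<Sum>\<sigma>\<in>{\<sigma> \<in> arrangements n. rise_excess n \<sigma> \<le> - b}. m_shuffle n m \<sigma>) \<ge>
    1 - exp (- (real n * b / L))"
proof -
  let ?A = "{\<sigma> \<in> arrangements n. rise_excess n \<sigma> \<le> - b}"
  let ?B = "arrangements n - ?A"
  have m0: "real m > 0" using m by simp
  have each: "m_shuffle n m \<sigma> \<le> exp (- (real n * b / L)) / fact n" if \<sigma>B: "\<sigma> \<in> ?B" for \<sigma>
  proof (cases "rising_sequences n \<sigma> \<le> m")
    case False
    then have "n + m - rising_sequences n \<sigma> < n" using n by linarith
    then have "m_shuffle n m \<sigma> = 0" by (simp add: m_shuffle_def binomial_eq_0)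
    then show ?thesis by simp
  next
    case True
    have \<sigma>: "\<sigma> \<in> arrangements n" and h: "rise_excess n \<sigma> > - b" using \<sigma>B by auto
    \<comment> \<open>A shuffle with fewer than \<open>b\<close> packs cannot produce as many rising sequences as
        \<open>h > - b\<close> requires, since \<open>4 b \<le> n\<close>.\<close>
    have bm: "b \<le> real m"
      using of_nat_mono[OF True, where 'a = real] h b unfolding rise_excess_def by argo
    define w where "w = real m - rise_excess n \<sigma>"
    have w: "0 < w" "w \<le> 2 * real m"
      using m_shuffle_likelihood_le(2)[OF \<sigma> n m True] h bm by (auto simp: w_def)
    have n2: "(real n)\<^sup>2 - 1 \<ge> 192 * real m * b"
      using mult_right_mono[OF mL, of b] b(1) L by linarith
    \<comment> \<open>The constant 192 is \<open>2 * 24 * 4\<close>: a factor 2 to beat the linear term, 24 from the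
        second-order term, and 4 from \<open>w \<le> 2 m\<close>.\<close>
    have "2 * real n * b / real m = real n * (192 * real m * b) / (24 * (2 * real m)\<^sup>2)"
      using m0 by (simp add: field_simps power2_eq_square)
    also have "\<dots> \<le> real n * ((real n)\<^sup>2 - 1) / (24 * (2 * real m)\<^sup>2)"
      by (intro divide_right_mono mult_left_mono n2) auto
    also have "\<dots> \<le> real n * ((real n)\<^sup>2 - 1) / (24 * w\<^sup>2)"
    proof (rule divide_left_mono)
      show "24 * w\<^sup>2 \<le> 24 * (2 * real m)\<^sup>2" using w power_mono[of w "2 * real m" 2] by simp
      show "0 \<le> real n * ((real n)\<^sup>2 - 1)" using n by (simp add: one_le_power)
      show "0 < 24 * (2 * real m)\<^sup>2 * (24 * w\<^sup>2)" using w m0 by simp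
    qed
    finally have 1: "2 * real n * b / real m \<le> real n * ((real n)\<^sup>2 - 1) / (24 * w\<^sup>2)" .
    have 2: "- (real n * rise_excess n \<sigma> / real m) \<le> real n * b / real m"
    proof -
      have "real n * (- rise_excess n \<sigma>) \<le> real n * b" by (rule mult_left_mono) (use h in auto)
      then have "real n * (- rise_excess n \<sigma>) / real m \<le> real n * b / real m"
        using m0 by (intro divide_right_mono) auto
      then show ?thesis by simp
    qed
    have 3: "real n * b / L \<le> real n * b / real m"
      using m0 mL b by (intro divide_left_mono) auto
    have "fact n * m_shuffle n m \<sigma> \<le> exp (- (real n * rise_excess n \<sigma> / real m) -
        real n * ((real n)\<^sup>2 - 1) / (24 * w\<^sup>2))"
      unfolding w_def by (rule m_shuffle_likelihood_le(1)[OF \<sigma> n m True])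
    also have "\<dots> \<le> exp (- (real n * b / L))"
    proof -
      have "2 * (real n * b / real m) \<le> real n * ((real n)\<^sup>2 - 1) / (24 * w\<^sup>2)"
        using 1 by (simp only: times_divide_eq_right mult.assoc)
      from diff_mono[OF 2 this]
      have "- (real n * rise_excess n \<sigma> / real m) - real n * ((real n)\<^sup>2 - 1) / (24 * w\<^sup>2)
          \<le> - (real n * b / real m)" by (simp add: mult.commute)
      also have "\<dots> \<le> - (real n * b / L)" using 3 by simp
      finally show ?thesis by (subst exp_le_cancel_iff)
    qed
    finally show ?thesis by (simp add: field_simps)
  qed
  have "(\<Sum>\<sigma>\<in>?B. m_shuffle n m \<sigma>) \<le> (\<Sum>\<sigma>\<in>?B. exp (- (real n * b / L)) / fact n)"
    by (rule sum_mono) (rule each)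
  also have "\<dots> \<le> (\<Sum>\<sigma>\<in>arrangements n. exp (- (real n * b / L)) / fact n)"
    by (rule sum_mono2[OF finite_arrangements]) auto
  also have "\<dots> = exp (- (real n * b / L))" by (simp add: card_arrangements)
  finally show ?thesis
    using sum_m_shuffle[OF n m] sum.subset_diff[of ?A "arrangements n" "m_shuffle n m"] finite_arrangements
    by auto
qed

section \<open>Moments of sums of independent summands\<close>

lemma abs_sum_list_map_le:
  fixes f :: "'a \<Rightarrow> real"
  assumes "xs \<in> set_pmf (replicate_pmf k p)" and bd: "\<And>x. x \<in> set_pmf p \<Longrightarrow> \<bar>f x\<bar> \<le> B"
  shows "\<bar>sum_list (map f xs)\<bar> \<le> real k * B"
proof -
  have "\<bar>sum_list (map f xs)\<bar> \<le> real (length xs) * B" if "xs \<in> lists (set_pmf p)"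
    using that
  proof (induction rule: lists.induct)
    case (Cons x xs)
    then show ?case using bd[of x] by (simp add: algebra_simps)
  qed simp
  then show ?thesis using assms(1) by (simp add: set_replicate_pmf)
qed

lemma expectation_sum_list:
  fixes f :: "'a \<Rightarrow> real"
  assumes bd: "\<And>x. x \<in> set_pmf p \<Longrightarrow> \<bar>f x\<bar> \<le> B"
  shows "measure_pmf.expectation (replicate_pmf k p) (\<lambda>xs. sum_list (map f xs)) =
    real k * measure_pmf.expectation p f"
proof (induction k)
  case (Suc k)
  let ?R = "replicate_pmf k p" and ?E = "measure_pmf.expectation"
  have i: "integrable ?R (\<lambda>xs. sum_list (map f xs))"
    by (rule integrable_pmf_bounded[OF abs_sum_list_map_le]) (use bd in auto)
  have f: "integrable p f" by (rule integrable_pmf_bounded[OF bd])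
  have "?E (replicate_pmf (Suc k) p) (\<lambda>xs. sum_list (map f xs)) =
      ?E p (\<lambda>x. ?E ?R (\<lambda>xs. sum_list (map f (x # xs))))"
    by (rule expectation_replicate_Suc[OF abs_sum_list_map_le[OF _ bd]])
  also have "\<dots> = ?E p (\<lambda>x. f x + real k * ?E p f)"
    using i by (simp add: Suc.IH)
  also have "\<dots> = real (Suc k) * ?E p f"
    using f by (simp add: algebra_simps)
  finally show ?case .
qed simp

lemma expectation_quadratic:
  fixes T :: "'a \<Rightarrow> real"
  assumes "integrable (measure_pmf M) T" "integrable (measure_pmf M) (\<lambda>x. (T x)\<^sup>2)"
  shows "measure_pmf.expectation M (\<lambda>x. c + d * T x + (T x)\<^sup>2) =
    c + d * measure_pmf.expectation M T + measure_pmf.expectation M (\<lambda>x. (T x)\<^sup>2)"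
  using assms by simp

text \<open>
  Induction on the number of summands: the centred partial sum has mean 0, so the mixed term
  vanishes when a further independent summand is added.
\<close>

lemma variance_sum_list_le:
  fixes f :: "'a \<Rightarrow> real"
  assumes bd: "\<And>x. x \<in> set_pmf p \<Longrightarrow> \<bar>f x\<bar> \<le> B"
  shows "measure_pmf.expectation (replicate_pmf k p)
      (\<lambda>xs. (sum_list (map f xs) - real k * measure_pmf.expectation p f)\<^sup>2) \<le>
    real k * measure_pmf.expectation p (\<lambda>x. (f x)\<^sup>2)"
proof -
  define \<mu> where "\<mu> = measure_pmf.expectation p f"
  define s where "s = measure_pmf.expectation p (\<lambda>x. (f x)\<^sup>2)"
  define T where "T k xs = sum_list (map f xs) - real k * \<mu>" for k xs
  define V where "V k = measure_pmf.expectation (replicate_pmf k p) (\<lambda>xs. (T k xs)\<^sup>2)" for k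
  have T: "\<bar>T k xs\<bar> \<le> 2 * (real k * B)" if "xs \<in> set_pmf (replicate_pmf k p)" for xs k
  proof -
    have "\<bar>real k * \<mu>\<bar> \<le> real k * B"
      using abs_expectation_le[of p f B, OF bd] by (simp add: abs_mult mult_left_mono \<mu>_def)
    then show ?thesis using abs_sum_list_map_le[of xs k p f B, OF that bd] unfolding T_def by linarith
  qed
  have T2: "\<bar>(T k xs)\<^sup>2\<bar> \<le> (2 * (real k * B))\<^sup>2" if "xs \<in> set_pmf (replicate_pmf k p)" for xs k
    using power_mono[OF T[OF that], of 2] by simp
  have iT: "integrable (replicate_pmf k p) (T k)" for k by (rule integrable_pmf_bounded[OF T])
  have iT2: "integrable (replicate_pmf k p) (\<lambda>xs. (T k xs)\<^sup>2)" for k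
    by (rule integrable_pmf_bounded[OF T2])
  have ET: "measure_pmf.expectation (replicate_pmf k p) (T k) = 0" for k
  proof -
    have "integrable (replicate_pmf k p) (\<lambda>xs. sum_list (map f xs))"
      by (rule integrable_pmf_bounded[OF abs_sum_list_map_le[OF _ bd]])
    moreover have "T k = (\<lambda>xs. sum_list (map f xs) - real k * \<mu>)" by (simp add: T_def fun_eq_iff)
    ultimately show ?thesis using expectation_sum_list[of p f B k, OF bd] by (simp add: \<mu>_def)
  qed
  have f: "integrable p f" by (rule integrable_pmf_bounded[OF bd])
  have f2: "integrable p (\<lambda>x. (f x)\<^sup>2)"
    by (rule integrable_pmf_bounded[where B = "B\<^sup>2"]) (use power_mono[OF bd, of _ 2] in simp)
  have step: "measure_pmf.expectation (replicate_pmf k p) (\<lambda>xs. (T (Suc k) (x # xs))\<^sup>2) =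
      (f x - \<mu>)\<^sup>2 + V k" for k x
  proof -
    have "(\<lambda>xs. (T (Suc k) (x # xs))\<^sup>2) = (\<lambda>xs. (f x - \<mu>)\<^sup>2 + 2 * (f x - \<mu>) * T k xs + (T k xs)\<^sup>2)"
      by (rule ext) (simp add: T_def power2_eq_square algebra_simps)
    then show ?thesis
      using expectation_quadratic[OF iT iT2, of k "(f x - \<mu>)\<^sup>2" "2 * (f x - \<mu>)"] by (simp add: ET V_def)
  qed
  have Suc: "V (Suc k) \<le> s + V k" for k
  proof -
    have "V (Suc k) = measure_pmf.expectation p (\<lambda>x. (f x - \<mu>)\<^sup>2 + V k)"
      unfolding V_def[of "Suc k"] step[symmetric]
      by (rule expectation_replicate_Suc[where f = "\<lambda>xs. (T (Suc k) xs)\<^sup>2", OF T2])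
    also have "(\<lambda>x. (f x - \<mu>)\<^sup>2 + V k) = (\<lambda>x. \<mu>\<^sup>2 + V k + - 2 * \<mu> * f x + (f x)\<^sup>2)"
      by (rule ext) (simp add: power2_eq_square algebra_simps)
    also have "measure_pmf.expectation p \<dots> = \<mu>\<^sup>2 + V k + - 2 * \<mu> * \<mu> + s"
      unfolding \<mu>_def[symmetric] s_def expectation_quadratic[OF f f2] ..
    also have "\<dots> \<le> s + V k" by (simp add: power2_eq_square)
    finally show ?thesis .
  qed
  have "V k \<le> real k * s"
  proof (induction k)
    case 0
    show ?case by (simp add: V_def T_def)
  next
    case (Suc k)
    then show ?case using \<open>V (Suc k) \<le> s + V k\<close> by (simp add: algebra_simps)
  qed
  then show ?thesis by (simp add: V_def T_def \<mu>_def s_def)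
qed

lemma prob_sum_list_deviation_le:
  fixes f :: "'a \<Rightarrow> real"
  assumes bd: "\<And>x. x \<in> set_pmf p \<Longrightarrow> \<bar>f x\<bar> \<le> B" and c: "c > 0"
  shows "measure_pmf.prob (replicate_pmf k p)
      {xs. c \<le> \<bar>sum_list (map f xs) - real k * measure_pmf.expectation p f\<bar>} \<le>
    real k * measure_pmf.expectation p (\<lambda>x. (f x)\<^sup>2) / c\<^sup>2"
proof -
  let ?R = "replicate_pmf k p" and ?\<mu> = "measure_pmf.expectation p f"
  let ?T = "\<lambda>xs. sum_list (map f xs) - real k * ?\<mu>"
  have T: "\<bar>?T xs\<bar> \<le> 2 * (real k * B)" if "xs \<in> set_pmf ?R" for xs
  proof -
    have "\<bar>real k * ?\<mu>\<bar> \<le> real k * B"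
      using abs_expectation_le[of p f B, OF bd] by (simp add: abs_mult mult_left_mono)
    then show ?thesis using abs_sum_list_map_le[of xs k p f B, OF that bd] by linarith
  qed
  have iT2: "integrable ?R (\<lambda>xs. (?T xs)\<^sup>2)"
    by (rule integrable_pmf_bounded[where B = "(2 * (real k * B))\<^sup>2"]) (use power_mono[OF T, of _ 2] in simp)
  have "measure_pmf.prob ?R {xs. c \<le> \<bar>?T xs\<bar>} =
      measure_pmf.expectation ?R (indicat_real {xs. c \<le> \<bar>?T xs\<bar>})" by simp
  also have "\<dots> \<le> measure_pmf.expectation ?R (\<lambda>xs. (?T xs)\<^sup>2 / c\<^sup>2)"
  proof (rule integral_mono)
    fix xs
    show "indicat_real {xs. c \<le> \<bar>?T xs\<bar>} xs \<le> (?T xs)\<^sup>2 / c\<^sup>2"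
      using c power_mono[of c "\<bar>?T xs\<bar>" 2] by (auto simp: indicator_def)
  qed (use iT2 integrable_indicator_pmf in auto)
  also have "\<dots> = measure_pmf.expectation ?R (\<lambda>xs. (?T xs)\<^sup>2) / c\<^sup>2" by simp
  also have "\<dots> \<le> real k * measure_pmf.expectation p (\<lambda>x. (f x)\<^sup>2) / c\<^sup>2"
    by (rule divide_right_mono[OF variance_sum_list_le[OF bd]]) auto
  finally show ?thesis .
qed

lemma prob_ex_in_list_le:
  "measure_pmf.prob (replicate_pmf k p) {xs. \<exists>x\<in>set xs. x \<in> S} \<le> real k * measure_pmf.prob p S"
proof -
  let ?R = "replicate_pmf k p" and ?f = "indicat_real S"
  have bd: "\<bar>?f x\<bar> \<le> 1" for x by (simp add: indicator_def)
  have pos: "0 \<le> sum_list (map ?f xs)" for xs by (rule sum_list_nonneg) auto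
  have "measure_pmf.prob ?R {xs. \<exists>x\<in>set xs. x \<in> S} =
      measure_pmf.expectation ?R (indicat_real {xs. \<exists>x\<in>set xs. x \<in> S})" by simp
  also have "\<dots> \<le> measure_pmf.expectation ?R (\<lambda>xs. sum_list (map ?f xs))"
  proof (rule integral_mono[OF integrable_indicator_pmf])
    show "integrable ?R (\<lambda>xs. sum_list (map ?f xs))"
      by (rule integrable_pmf_bounded[OF abs_sum_list_map_le]) (use bd in auto)
    fix xs
    have "\<exists>x\<in>set xs. x \<in> S \<Longrightarrow> 1 \<le> sum_list (map ?f xs)"
    proof (induction xs)
      case (Cons y ys)
      then show ?case using pos[of ys] by (cases "y \<in> S") auto
    qed simp
    then show "indicat_real {xs. \<exists>x\<in>set xs. x \<in> S} xs \<le> sum_list (map ?f xs)"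
      using pos[of xs] by (auto simp: indicator_def)
  qed
  also have "\<dots> = real k * measure_pmf.prob p S"
    by (subst expectation_sum_list[where B = 1]) (use bd in auto)
  finally show ?thesis .
qed

section \<open>The number of packs after repeated shuffling\<close>

definition EZ :: "nat pmf \<Rightarrow> real \<Rightarrow> real" where
  "EZ p a = measure_pmf.expectation p (trunc_Z a)"

lemma trunc_bounds:
  assumes "x \<ge> 1" "a > 0"
  shows "0 \<le> trunc_Y a x" "trunc_Y a x \<le> trunc_Z a x" "trunc_Z a x \<le> a" "trunc_Z a x \<le> ln (real x)"
  using assms by (auto simp: trunc_Y_def trunc_Z_def)

lemma ln_prod_list:
  assumes "xs \<in> lists {1..}"
  shows "ln (real (prod_list xs)) = sum_list (map (\<lambda>x. ln (real x)) xs)" "prod_list xs \<ge> 1"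
  using assms
proof (induction rule: lists.induct)
  case (Cons x xs)
  {
    case 1
    show ?case using Cons.hyps Cons.IH by (simp add: ln_mult)
  next
    case 2
    show ?case using Cons.hyps Cons.IH by simp
  }
qed simp_all

lemma measure_pack_count: "measure_pmf.prob (pack_count k p) S = measure_pmf.prob (replicate_pmf k p) {xs. prod_list xs \<in> S}"
  by (simp add: pack_count_def measure_map_pmf vimage_def)

lemma measure_pmf_mono_support:
  assumes "\<And>x. x \<in> set_pmf p \<Longrightarrow> x \<in> A \<Longrightarrow> x \<in> B"
  shows "measure_pmf.prob p A \<le> measure_pmf.prob p B"
  by (rule measure_pmf.finite_measure_mono_AE) (use assms in \<open>auto simp: AE_measure_pmf_iff\<close>)

context
  fixes p :: "nat pmf" and a :: real
  assumes p: "set_pmf p \<subseteq> {1..}" and a: "a > 0"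
begin

lemma trunc_abs_le:
  assumes "x \<in> set_pmf p"
  shows "\<bar>trunc_Y a x\<bar> \<le> a" "\<bar>trunc_Z a x\<bar> \<le> a"
proof -
  have "x \<ge> 1" using assms p by auto
  from trunc_bounds[OF this a] show "\<bar>trunc_Y a x\<bar> \<le> a" "\<bar>trunc_Z a x\<bar> \<le> a" by auto
qed

lemma integrable_trunc_Z_sq: "integrable p (\<lambda>x. (trunc_Z a x)\<^sup>2)"
  by (rule integrable_pmf_bounded[where B = "a\<^sup>2"]) (use power_mono[OF trunc_abs_le(2), of _ 2] in simp)

lemma EY_nonneg: "EY p a \<ge> 0"
  unfolding EY_def using p trunc_bounds(1)[OF _ a]
  by (intro integral_nonneg_AE) (auto simp: AE_measure_pmf_iff subset_iff)

lemma EY_le_EZ: "EY p a \<le> EZ p a"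
  unfolding EY_def EZ_def
proof (rule integral_mono_AE)
  show "integrable p (trunc_Y a)" "integrable p (trunc_Z a)"
    using trunc_abs_le by (auto intro: integrable_pmf_bounded[where B = a])
  show "AE x in p. trunc_Y a x \<le> trunc_Z a x"
    using p trunc_bounds(2)[OF _ a] by (auto simp: AE_measure_pmf_iff subset_iff)
qed

lemma expectation_trunc_Y_sq_le: "measure_pmf.expectation p (\<lambda>x. (trunc_Y a x)\<^sup>2) \<le> EZ2 p a"
  unfolding EZ2_def
proof (rule integral_mono_AE)
  show "integrable p (\<lambda>x. (trunc_Y a x)\<^sup>2)"
    by (rule integrable_pmf_bounded[where B = "a\<^sup>2"]) (use power_mono[OF trunc_abs_le(1), of _ 2] in simp)
  show "AE x in p. (trunc_Y a x)\<^sup>2 \<le> (trunc_Z a x)\<^sup>2"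
    using p trunc_bounds(1,2)[OF _ a] by (auto simp: AE_measure_pmf_iff subset_iff intro!: power_mono)
qed (rule integrable_trunc_Z_sq)

lemma prob_truncated_le: "measure_pmf.prob p {x. ln (real x) > a} \<le> EZ2 p a / a\<^sup>2"
proof -
  have "measure_pmf.prob p {x. ln (real x) > a} = measure_pmf.expectation p (indicat_real {x. ln (real x) > a})"
    by simp
  also have "\<dots> \<le> measure_pmf.expectation p (\<lambda>x. (trunc_Z a x)\<^sup>2 / a\<^sup>2)"
    by (rule integral_mono[OF integrable_indicator_pmf])
      (use integrable_trunc_Z_sq a in \<open>auto simp: trunc_Z_def indicator_def\<close>)
  finally show ?thesis by (simp add: EZ2_def)
qed

lemma EZ2_nonneg: "EZ2 p a \<ge> 0"
  unfolding EZ2_def by (rule integral_nonneg_AE) simp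

text \<open>
  In the limit condition this positivity excludes \<open>E Y = 0\<close>, as the quotient would be infinite.
\<close>

lemma EZ2_pos:
  assumes "(\<integral>\<^sup>+x. ennreal (ln (real x)) \<partial>measure_pmf p) > 0"
  shows "EZ2 p a > 0"
proof (rule ccontr)
  assume "\<not> EZ2 p a > 0"
  then have "EZ2 p a = 0" using EZ2_nonneg by simp
  then have "AE x in p. (trunc_Z a x)\<^sup>2 = 0"
    unfolding EZ2_def using integral_nonneg_eq_0_iff_AE[OF integrable_trunc_Z_sq] by simp
  then have "AE x in p. ennreal (ln (real x)) = 0"
    using a by (auto simp: AE_measure_pmf_iff trunc_Z_def split: if_splits)
  then have "(\<integral>\<^sup>+x. ennreal (ln (real x)) \<partial>measure_pmf p) = (\<integral>\<^sup>+x. 0 \<partial>measure_pmf p)"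
    by (rule nn_integral_cong_AE)
  with assms show False by simp
qed

text \<open>
  Truncation only lowers the logarithms, so a small product forces the sum of the bounded
  variables \<open>Z\<close> to fall below its mean.
\<close>

lemma prob_few_packs_le:
  assumes s: "s < real k * EZ p a"
  shows "measure_pmf.prob (pack_count k p) {m. real m < exp s} \<le>
    real k * EZ2 p a / (real k * EZ p a - s)\<^sup>2"
proof -
  have "measure_pmf.prob (pack_count k p) {m. real m < exp s} \<le>
      measure_pmf.prob (replicate_pmf k p)
        {xs. real k * EZ p a - s \<le> \<bar>sum_list (map (trunc_Z a) xs) - real k * EZ p a\<bar>}"
    unfolding measure_pack_count
  proof (rule measure_pmf_mono_support)
    fix xs assume xs: "xs \<in> set_pmf (replicate_pmf k p)" and "xs \<in> {xs. prod_list xs \<in> {m. real m < exp s}}"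
    then have small: "real (prod_list xs) < exp s" by simp
    have l: "xs \<in> lists {1..}" using xs p by (auto simp: set_replicate_pmf)
    have "sum_list (map (trunc_Z a) xs) \<le> sum_list (map (\<lambda>x. ln (real x)) xs)"
      by (rule sum_list_mono) (use l trunc_bounds(4)[OF _ a] in auto)
    also have "\<dots> = ln (real (prod_list xs))" by (rule ln_prod_list(1)[OF l, symmetric])
    also have "\<dots> < s"
      using small ln_prod_list(2)[OF l] by (metis exp_gt_zero ln_exp ln_less_cancel_iff of_nat_0_less_iff
          less_le_trans zero_less_one)
    finally show "xs \<in> {xs. real k * EZ p a - s \<le> \<bar>sum_list (map (trunc_Z a) xs) - real k * EZ p a\<bar>}"
      by simp
  qed
  also have "\<dots> \<le> real k * EZ2 p a / (real k * EZ p a - s)\<^sup>2"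
    unfolding EZ_def EZ2_def
    by (rule prob_sum_list_deviation_le[OF trunc_abs_le(2)]) (use s in \<open>auto simp: EZ_def\<close>)
  finally show ?thesis .
qed

text \<open>
  Either some logarithm exceeds the truncation level, or the logarithm of the product is the sum
  of the \<open>Y\<close> and lies above its mean.
\<close>

lemma prob_many_packs_le:
  assumes s: "s > real k * EY p a"
  shows "measure_pmf.prob (pack_count k p) {m. real m > exp s} \<le>
    real k * EZ2 p a / a\<^sup>2 + real k * EZ2 p a / (s - real k * EY p a)\<^sup>2"
proof -
  let ?R = "replicate_pmf k p"
  let ?U = "{xs. \<exists>x\<in>set xs. x \<in> {x. ln (real x) > a}}"
  let ?V = "{xs. s - real k * EY p a \<le> \<bar>sum_list (map (trunc_Y a) xs) - real k * EY p a\<bar>}"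
  have "measure_pmf.prob (pack_count k p) {m. real m > exp s} \<le> measure_pmf.prob ?R (?U \<union> ?V)"
    unfolding measure_pack_count
  proof (rule measure_pmf_mono_support)
    fix xs assume xs: "xs \<in> set_pmf ?R" and "xs \<in> {xs. prod_list xs \<in> {m. real m > exp s}}"
    then have big: "real (prod_list xs) > exp s" by simp
    have l: "xs \<in> lists {1..}" using xs p by (auto simp: set_replicate_pmf)
    show "xs \<in> ?U \<union> ?V"
    proof (cases "xs \<in> ?U")
      case False
      then have eq: "map (trunc_Y a) xs = map (\<lambda>x. ln (real x)) xs"
        by (auto simp: trunc_Y_def not_less)
      have "sum_list (map (trunc_Y a) xs) = ln (real (prod_list xs))"
        unfolding eq by (rule ln_prod_list(1)[OF l, symmetric])
      also have "\<dots> > s"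
        using big by (metis exp_gt_zero ln_exp ln_less_cancel_iff less_trans)
      finally show ?thesis by auto
    qed simp
  qed
  also have "\<dots> \<le> measure_pmf.prob ?R ?U + measure_pmf.prob ?R ?V"
    by (rule measure_Un_le) auto
  also have "\<dots> \<le> real k * (EZ2 p a / a\<^sup>2) + real k * EZ2 p a / (s - real k * EY p a)\<^sup>2"
  proof (rule add_mono)
    show "measure_pmf.prob ?R ?U \<le> real k * (EZ2 p a / a\<^sup>2)"
      by (rule order_trans[OF prob_ex_in_list_le]) (rule mult_left_mono[OF prob_truncated_le], simp)
    have "measure_pmf.prob ?R ?V \<le>
        real k * measure_pmf.expectation p (\<lambda>x. (trunc_Y a x)\<^sup>2) / (s - real k * EY p a)\<^sup>2"
      unfolding EY_def
      by (rule prob_sum_list_deviation_le[OF trunc_abs_le(1)]) (use s in \<open>auto simp: EY_def\<close>)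
    also have "\<dots> \<le> real k * EZ2 p a / (s - real k * EY p a)\<^sup>2"
      by (intro divide_right_mono mult_left_mono expectation_trunc_Y_sq_le) auto
    finally show "measure_pmf.prob ?R ?V \<le> real k * EZ2 p a / (s - real k * EY p a)\<^sup>2" .
  qed
  finally show ?thesis by simp
qed

end

section \<open>Cutoff\<close>

lemma mixing_error_tendsto_0:
  assumes "d > 0"
  shows "(\<lambda>n. real n * sqrt (real n) / real n powr (3/2 + d) + 2 * real n ^ 3 / (real n powr (3/2 + d))\<^sup>2)
    \<longlonglongrightarrow> 0"
  using assms by real_asymp

lemma eventually_twice_le_powr: "d > 0 \<Longrightarrow> \<forall>\<^sub>F n in sequentially. 2 * real n \<le> real n powr (3/2 + d)"
  by real_asymp

text \<open>
  Pack numbers up to \<open>L = n powr (3/2 - d)\<close> are separated from uniform by the threshold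
  \<open>b = n powr (1/2 + d/2)\<close>. The exponent of \<open>b\<close> lies halfway between \<open>1/2\<close>, needed for the event to
  be rare under the uniform distribution, and \<open>1/2 + d\<close>, below which \<open>L b\<close> is small compared with
  \<open>n\<^sup>2\<close>.
\<close>

lemma eventually_separation_conditions:
  assumes "0 < d" "d < 1"
  shows "\<forall>\<^sub>F n in sequentially. 4 * real n powr (1/2 + d/2) \<le> real n"
    "\<forall>\<^sub>F n in sequentially. 192 * real n powr (3/2 - d) * real n powr (1/2 + d/2) \<le> (real n)\<^sup>2 - 1"
    "(\<lambda>n. exp (- (real n * real n powr (1/2 + d/2) / real n powr (3/2 - d)))) \<longlonglongrightarrow> 0"
    "(\<lambda>n. real n / (real n powr (1/2 + d/2))\<^sup>2) \<longlonglongrightarrow> 0"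
  using assms by (real_asymp, real_asymp, real_asymp, real_asymp)

lemma tv_dist_p_shuffle:
  assumes "set_pmf p \<subseteq> {1..}" "n \<ge> 1"
  shows "tv_dist n (convolution_power n (p_shuffle n p) k) (uniform_mass n) =
    tv_dist n (shuffle_mixture n (pack_count k p)) (uniform_mass n)"
  by (rule tv_dist_cong) (rule convolution_power_eq_mixture[OF assms])

lemma tv_dist_le_prob_few_packs:
  assumes p: "set_pmf p \<subseteq> {1..}" and n: "n \<ge> 1" and d: "2 * real n \<le> real n powr (3/2 + d)"
  shows "tv_dist n (convolution_power n (p_shuffle n p) k) (uniform_mass n) \<le>
    measure_pmf.prob (pack_count k p) {m. real m < exp ((3/2 + d) * ln (real n))} +
    (real n * sqrt (real n) / real n powr (3/2 + d) + 2 * real n ^ 3 / (real n powr (3/2 + d))\<^sup>2)"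
proof -
  let ?L = "real n powr (3/2 + d)"
  have L: "?L = exp ((3/2 + d) * ln (real n))" "?L > 0" using n by (simp_all add: powr_def)
  have "tv_dist n (shuffle_mixture n (pack_count k p)) (uniform_mass n) \<le>
      measure_pmf.prob (pack_count k p) {m. real m < ?L} + (real n * sqrt (real n) / ?L + 2 * real n ^ 3 / ?L\<^sup>2)"
  proof (rule tv_dist_mixture_le[OF n set_pack_count[OF p]])
    fix m A assume m: "real m \<ge> ?L" "m \<ge> 1" and A: "A \<subseteq> arrangements n"
    have "(\<Sum>\<sigma>\<in>A. m_shuffle n m \<sigma>) - (\<Sum>\<sigma>\<in>A. uniform_mass n \<sigma>) \<le>
        real n * sqrt (real n) / real m + 2 * real n ^ 3 / (real m)\<^sup>2"
      by (rule m_shuffle_near_uniform[OF n _ A]) (use m d in linarith)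
    also have "\<dots> \<le> real n * sqrt (real n) / ?L + 2 * real n ^ 3 / ?L\<^sup>2"
      using m(1) L(2) less_le_trans[OF L(2) m(1)]
      by (intro add_mono divide_left_mono power_mono mult_pos_pos zero_less_power) auto
    finally show "(\<Sum>\<sigma>\<in>A. m_shuffle n m \<sigma>) - (\<Sum>\<sigma>\<in>A. uniform_mass n \<sigma>) \<le>
        real n * sqrt (real n) / ?L + 2 * real n ^ 3 / ?L\<^sup>2" .
  qed simp
  then show ?thesis unfolding tv_dist_p_shuffle[OF p n] by (simp only: L(1))
qed

lemma tv_dist_ge_prob_many_packs:
  assumes p: "set_pmf p \<subseteq> {1..}" and n: "n \<ge> 1"
    and b: "4 * real n powr (1/2 + d/2) \<le> real n"
    and L: "192 * real n powr (3/2 - d) * real n powr (1/2 + d/2) \<le> (real n)\<^sup>2 - 1"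
  shows "1 - exp (- (real n * real n powr (1/2 + d/2) / real n powr (3/2 - d)))
      - measure_pmf.prob (pack_count k p) {m. real m > exp ((3/2 - d) * ln (real n))}
      - real n / (real n powr (1/2 + d/2))\<^sup>2
    \<le> tv_dist n (convolution_power n (p_shuffle n p) k) (uniform_mass n)"
proof -
  let ?L = "real n powr (3/2 - d)" and ?b = "real n powr (1/2 + d/2)"
  let ?A = "{\<sigma> \<in> arrangements n. rise_excess n \<sigma> \<le> - ?b}"
  have b0: "?b > 0" using n by simp
  have "1 - exp (- (real n * ?b / ?L)) - measure_pmf.prob (pack_count k p) {m. real m > ?L}
      - (\<Sum>\<sigma>\<in>?A. uniform_mass n \<sigma>) \<le> tv_dist n (shuffle_mixture n (pack_count k p)) (uniform_mass n)"
    by (rule tv_dist_mixture_ge[OF n set_pack_count[OF p]])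
      (use m_shuffle_low_rise_excess_ge[OF n _ b0 b _ L] in auto)
  moreover have "(\<Sum>\<sigma>\<in>?A. uniform_mass n \<sigma>) \<le> real n / ?b\<^sup>2"
    by (rule uniform_low_rise_excess_le[OF n b0])
  moreover have "?L = exp ((3/2 - d) * ln (real n))" using n by (simp add: powr_def)
  ultimately show ?thesis unfolding tv_dist_p_shuffle[OF p n] by simp
qed

lemma tv_dist_p_shuffle_le_1:
  assumes p: "set_pmf p \<subseteq> {1..}" and n: "n \<ge> 1"
  shows "tv_dist n (convolution_power n (p_shuffle n p) k) (uniform_mass n) \<le> 1"
  unfolding tv_dist_p_shuffle[OF p n] by (rule tv_dist_mixture_le_1[OF n set_pack_count[OF p]])

text \<open>
  The bound is uniform in \<open>k\<close>: the mean of the sum grows like \<open>k\<close> and its standard deviation only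
  like \<open>sqrt k\<close>, so the smallest admissible \<open>k\<close> is the worst one.
\<close>

lemma prob_few_packs_after_cutoff:
  assumes p: "set_pmf p \<subseteq> {1..}" and a: "a > 0" and EY: "EY p a > 0" and l: "l > 0"
    and v: "0 < v" "v < w" and k: "real k * EY p a > w * l"
  shows "measure_pmf.prob (pack_count k p) {m. real m < exp (v * l)} \<le>
    EZ2 p a / (l * EY p a) / ((1 - v / w)\<^sup>2 * w)"
proof -
  let ?K = "real k * EZ p a" and ?Y = "real k * EY p a"
  have wl: "w * l > 0" using v l by simp
  have YK: "?Y \<le> ?K" using EY_le_EZ[OF p a] by (intro mult_left_mono) auto
  have k0: "real k > 0" using k wl EY by (cases k) auto
  have eta: "0 < 1 - v / w" using v by simp
  have vl: "v * l \<le> v / w * ?Y"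
  proof -
    have "v / w * (w * l) \<le> v / w * ?Y" using v k by (intro mult_left_mono) auto
    then show ?thesis using v by simp
  qed
  have dev: "(1 - v / w) * ?Y \<le> ?K - v * l"
    using vl YK by (simp add: algebra_simps)
  have Y0: "?Y > 0" using k wl by linarith
  then have dev0: "(1 - v / w) * ?Y > 0" using eta by simp
  have "measure_pmf.prob (pack_count k p) {m. real m < exp (v * l)} \<le>
      real k * EZ2 p a / (?K - v * l)\<^sup>2"
    by (rule prob_few_packs_le[OF p a]) (use dev dev0 in linarith)
  also have "\<dots> \<le> real k * EZ2 p a / ((1 - v / w) * ?Y)\<^sup>2"
  proof (rule divide_left_mono)
    show "((1 - v / w) * ?Y)\<^sup>2 \<le> (?K - v * l)\<^sup>2" using dev dev0 by (intro power_mono) auto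
    show "0 < (?K - v * l)\<^sup>2 * ((1 - v / w) * ?Y)\<^sup>2"
      by (intro mult_pos_pos[OF zero_less_power zero_less_power] dev0 less_le_trans[OF dev0 dev])
  qed (simp add: EZ2_nonneg[OF p a])
  also have "\<dots> = EZ2 p a / ((1 - v / w)\<^sup>2 * ?Y * EY p a)"
  proof -
    have "real k * EZ2 p a / (\<eta> * ?Y)\<^sup>2 = EZ2 p a / (\<eta>\<^sup>2 * ?Y * EY p a)" if "\<eta> > 0" for \<eta> :: real
      using k0 EY that by (simp add: power2_eq_square divide_simps)
    then show ?thesis using eta .
  qed
  also have "\<dots> \<le> EZ2 p a / ((1 - v / w)\<^sup>2 * (w * l) * EY p a)"
    using k k0 v l EY eta wl Y0 EZ2_nonneg[OF p a]
    by (intro divide_left_mono mult_right_mono mult_left_mono mult_pos_pos) auto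
  also have "\<dots> = EZ2 p a / (l * EY p a) / ((1 - v / w)\<^sup>2 * w)"
    by (simp add: mult_ac)
  finally show ?thesis .
qed

lemma prob_many_packs_before_cutoff:
  assumes p: "set_pmf p \<subseteq> {1..}" and a: "a > 0" and EY: "EY p a > 0" and l: "l > 0"
    and w: "0 < w" "w < v" and k: "real k * EY p a < w * l"
  shows "measure_pmf.prob (pack_count k p) {m. real m > exp (v * l)} \<le>
    w * (l * EZ2 p a / (a\<^sup>2 * EY p a)) + w / (v - w)\<^sup>2 * (EZ2 p a / (l * EY p a))"
proof -
  have kle: "real k \<le> w * l / EY p a" using k EY by (simp add: field_simps)
  have dev: "(v - w) * l \<le> v * l - real k * EY p a" using k by (simp add: algebra_simps)
  have dev0: "(v - w) * l > 0" using w l by simp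
  note Z = EZ2_nonneg[OF p a]
  have "measure_pmf.prob (pack_count k p) {m. real m > exp (v * l)} \<le>
      real k * EZ2 p a / a\<^sup>2 + real k * EZ2 p a / (v * l - real k * EY p a)\<^sup>2"
    by (rule prob_many_packs_le[OF p a]) (use dev dev0 in linarith)
  also have "\<dots> \<le> (w * l / EY p a) * EZ2 p a / a\<^sup>2 + (w * l / EY p a) * EZ2 p a / ((v - w) * l)\<^sup>2"
  proof (intro add_mono divide_right_mono mult_right_mono kle Z frac_le)
    show "((v - w) * l)\<^sup>2 \<le> (v * l - real k * EY p a)\<^sup>2" using dev dev0 by (intro power_mono) auto
    show "0 < ((v - w) * l)\<^sup>2" using dev0 by (rule zero_less_power)
    show "0 \<le> w * l / EY p a * EZ2 p a" using w l EY Z by simp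
  qed auto
  also have "\<dots> = w * (l * EZ2 p a / (a\<^sup>2 * EY p a)) + w / (v - w)\<^sup>2 * (EZ2 p a / (l * EY p a))"
    using l by (simp add: power2_eq_square mult_ac)
  finally show ?thesis .
qed

(* Quotients are taken in ereal, where x / 0 = \<infinity> for x > 0. *)
theorem theorem3p4:
  fixes p :: "nat \<Rightarrow> nat pmf" and a :: "nat \<Rightarrow> real"
  assumes "\<And>n. n \<ge> 1 \<Longrightarrow> set_pmf (p n) \<subseteq> {1..}"
    and "\<And>n. n \<ge> 1 \<Longrightarrow> (\<integral>\<^sup>+x. ennreal (ln (real x)) \<partial>measure_pmf (p n)) > 0"
    and "\<And>n. n \<ge> 1 \<Longrightarrow> a n > 0"
    and "filterlim a at_top sequentially"
    and "a \<in> O(\<lambda>n. ln (real n))"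
    and "(\<lambda>n. ereal (ln (real n) * EZ2 (p n) (a n)) / ereal ((a n)\<^sup>2 * EY (p n) (a n)))
           \<longlonglongrightarrow> 0"
    and "(\<lambda>n. ereal (ln (real n)) / ereal (EY (p n) (a n))) \<longlonglongrightarrow> \<infinity>"
  shows "tv_cutoff (\<lambda>n. p_shuffle n (p n))
           (\<lambda>n. ereal (3 * ln (real n)) / ereal (2 * EY (p n) (a n)))"
proof -
  note p = assms(1) and a = assms(3)
  define l y z where "l n = ln (real n)" and "y n = EY (p n) (a n)" and "z n = EZ2 (p n) (a n)" for n
  define q g where "q n = l n * z n / ((a n)\<^sup>2 * y n)" and "g n = z n / (l n * y n)" for n
  define tv where "tv k n = tv_dist n (convolution_power n (p_shuffle n (p n)) (k n)) (uniform_mass n)"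
    for k :: "nat \<Rightarrow> nat" and n
  let ?t = "\<lambda>n. ereal (3 * ln (real n)) / ereal (2 * EY (p n) (a n))"

  \<comment> \<open>An infinite quotient cannot occur in a sequence tending to 0, so \<open>E Y > 0\<close> eventually.\<close>
  have good: "\<forall>\<^sub>F n in sequentially. n \<ge> 2 \<and> l n > 0 \<and> y n > 0"
  proof -
    have "\<forall>\<^sub>F n in sequentially.
        ereal (ln (real n) * EZ2 (p n) (a n)) / ereal ((a n)\<^sup>2 * EY (p n) (a n)) < 1"
      by (rule order_tendstoD(2)[OF assms(6)]) simp
    then show ?thesis
      using eventually_ge_at_top[of 2]
    proof eventually_elim
      case (elim n)
      then have n: "n \<ge> 1" by simp
      have l: "l n > 0" using elim(2) by (simp add: l_def)
      have "z n > 0" using EZ2_pos[OF p[OF n] a[OF n] assms(2)[OF n]] by (simp add: z_def)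
      then have "y n \<noteq> 0" using elim(1) l by (auto simp: l_def z_def y_def)
      then have "y n > 0" using EY_nonneg[OF p[OF n] a[OF n]] by (simp add: y_def)
      then show ?case using l elim(2) by simp
    qed
  qed
  have t: "?t n = ereal (3 * l n / (2 * y n))" if "y n > 0" for n
    using that by (simp add: l_def y_def)
  have q0: "q \<longlonglongrightarrow> 0"
  proof -
    have "\<forall>\<^sub>F n in sequentially.
        ereal (ln (real n) * EZ2 (p n) (a n)) / ereal ((a n)\<^sup>2 * EY (p n) (a n)) = ereal (q n)"
      using good
    proof eventually_elim
      case (elim n)
      then have "a n > 0" "y n > 0" using a[of n] by auto
      then show ?case by (simp add: q_def l_def z_def y_def)
    qed
    then have "(\<lambda>n. ereal (q n)) \<longlonglongrightarrow> 0" using assms(6) by (simp add: tendsto_cong)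
    then show ?thesis by (simp add: zero_ereal_def)
  qed
  \<comment> \<open>As \<open>g = q (a / ln n)\<^sup>2\<close>, the growth condition on \<open>a\<close> transfers the limit from \<open>q\<close> to \<open>g\<close>.\<close>
  have g0: "g \<longlonglongrightarrow> 0"
  proof -
    obtain c where c: "c > 0" "\<forall>\<^sub>F n in sequentially. norm (a n) \<le> c * norm (ln (real n))"
      using landau_o.bigE[OF assms(5)] by blast
    have "\<forall>\<^sub>F n in sequentially. norm (g n) \<le> c\<^sup>2 * q n"
      using c(2) good
    proof eventually_elim
      case (elim n)
      then have n: "n \<ge> 1" by simp
      have zn: "z n \<ge> 0" using EZ2_nonneg[OF p[OF n] a[OF n]] by (simp add: z_def)
      have an: "a n > 0" by (rule a[OF n])
      have "(a n)\<^sup>2 \<le> (c * l n)\<^sup>2"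
        using elim an by (intro power_mono) (auto simp: l_def)
      then have "(a n)\<^sup>2 / (l n)\<^sup>2 \<le> c\<^sup>2" using elim by (simp add: field_simps power_mult_distrib)
      moreover have "q n \<ge> 0" using elim an zn by (simp add: q_def)
      ultimately have "(a n)\<^sup>2 / (l n)\<^sup>2 * q n \<le> c\<^sup>2 * q n" by (rule mult_right_mono)
      moreover have "(a n)\<^sup>2 / (l n)\<^sup>2 * q n = g n"
        using elim an by (simp add: q_def g_def power2_eq_square)
      moreover have "g n \<ge> 0" using elim zn by (simp add: g_def)
      ultimately show ?case by simp
    qed
    moreover have "(\<lambda>n. c\<^sup>2 * q n) \<longlonglongrightarrow> 0" using tendsto_mult_left[OF q0, of "c\<^sup>2"] by simp
    ultimately show ?thesis by (rule Lim_null_comparison)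
  qed

  have upper: "tv k \<longlonglongrightarrow> 0"
    if \<epsilon>: "0 < \<epsilon>" "\<epsilon> < 1" and k: "\<forall>\<^sub>F n in sequentially. ereal (real (k n)) > ereal (1 + \<epsilon>) * ?t n"
    for \<epsilon> :: real and k
  proof -
    \<comment> \<open>In units of \<open>ln n\<close> the mean of \<open>ln M\<close> exceeds \<open>w = (3/2) (1 + \<epsilon>)\<close>; the pack number
        needed for mixing has logarithm \<open>3/2 + d = (3/2) (1 + \<epsilon>/2)\<close>, halfway back to \<open>3/2\<close>.\<close>
    define d w C where "d = 3 * \<epsilon> / 4" and "w = 3 / 2 * (1 + \<epsilon>)" and "C = (1 - (3/2 + d) / w)\<^sup>2 * w"
    have d: "d > 0" "3/2 + d < w" using \<epsilon> by (auto simp: d_def w_def)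
    define err where "err n = real n * sqrt (real n) / real n powr (3/2 + d) +
      2 * real n ^ 3 / (real n powr (3/2 + d))\<^sup>2" for n
    have "\<forall>\<^sub>F n in sequentially. norm (tv k n) \<le> g n / C + err n"
      using good k eventually_twice_le_powr[OF d(1)]
    proof eventually_elim
      case (elim n)
      then have n: "n \<ge> 1" by simp
      have "real (k n) > (1 + \<epsilon>) * (3 * l n / (2 * y n))" using elim t by simp
      then have "real (k n) * y n > w * l n" using elim by (simp add: w_def field_simps)
      then have "measure_pmf.prob (pack_count (k n) (p n)) {m. real m < exp ((3/2 + d) * l n)} \<le> g n / C"
        unfolding g_def C_def y_def z_def
        by (intro prob_few_packs_after_cutoff p[OF n] a[OF n]) (use elim d in \<open>auto simp: y_def\<close>)
      then show ?case
        using tv_dist_le_prob_few_packs[OF p[OF n] n elim(3), of "k n"] tv_dist_nonneg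
        by (simp add: tv_def err_def l_def)
    qed
    moreover have "(\<lambda>n. g n / C + err n) \<longlonglongrightarrow> 0"
      using tendsto_add[OF tendsto_divide_zero[OF g0, of C] mixing_error_tendsto_0[OF d(1)]]
      by (simp add: err_def)
    ultimately show ?thesis by (rule Lim_null_comparison)
  qed

  have lower: "tv k \<longlonglongrightarrow> 1"
    if \<epsilon>: "0 < \<epsilon>" "\<epsilon> < 1" and k: "\<forall>\<^sub>F n in sequentially. ereal (real (k n)) < ereal (1 - \<epsilon>) * ?t n"
    for \<epsilon> :: real and k
  proof -
    \<comment> \<open>Again \<open>3/2 - d\<close> is halfway between \<open>3/2\<close> and the bound \<open>w\<close> for the mean.\<close>
    define d w where "d = 3 * \<epsilon> / 4" and "w = 3 / 2 * (1 - \<epsilon>)"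
    have d: "0 < d" "d < 1" "0 < w" "w < 3/2 - d" using \<epsilon> by (auto simp: d_def w_def)
    define P where "P n = w * q n + w / (3/2 - d - w)\<^sup>2 * g n" for n
    define e where "e n = exp (- (real n * real n powr (1/2 + d/2) / real n powr (3/2 - d)))" for n
    define u where "u n = real n / (real n powr (1/2 + d/2))\<^sup>2" for n
    have "\<forall>\<^sub>F n in sequentially. 1 - e n - P n - u n \<le> tv k n \<and> tv k n \<le> 1"
      using good k eventually_separation_conditions(1,2)[OF d(1,2)]
    proof eventually_elim
      case (elim n)
      then have n: "n \<ge> 1" by simp
      have "real (k n) < (1 - \<epsilon>) * (3 * l n / (2 * y n))" using elim t by simp
      then have "real (k n) * y n < w * l n" using elim by (simp add: w_def field_simps)
      then have "measure_pmf.prob (pack_count (k n) (p n)) {m. real m > exp ((3/2 - d) * l n)} \<le> P n"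
        unfolding P_def q_def g_def y_def z_def
        by (intro prob_many_packs_before_cutoff p[OF n] a[OF n]) (use elim d in \<open>auto simp: y_def\<close>)
      then show ?case
        using tv_dist_ge_prob_many_packs[OF p[OF n] n elim(3,4), of "k n"]
          tv_dist_p_shuffle_le_1[OF p[OF n] n, of "k n"]
        by (simp add: tv_def e_def u_def l_def)
    qed
    then have ev: "\<forall>\<^sub>F n in sequentially. 1 - e n - P n - u n \<le> tv k n"
      "\<forall>\<^sub>F n in sequentially. tv k n \<le> 1"
      by (auto elim: eventually_mono)
    have "P \<longlonglongrightarrow> w * 0 + w / (3/2 - d - w)\<^sup>2 * 0"
      unfolding P_def by (intro tendsto_intros q0 g0)
    then have "(\<lambda>n. 1 - e n - P n - u n) \<longlonglongrightarrow> 1 - 0 - 0 - 0"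
      unfolding e_def u_def
      by (intro tendsto_diff tendsto_const eventually_separation_conditions(3,4)[OF d(1,2)]) simp
    then show ?thesis
      using ev by (intro tendsto_sandwich[OF ev(1) ev(2) _ tendsto_const]) simp
  qed

  have "\<forall>\<^sub>F n in sequentially. 0 < ?t n \<and> ?t n < \<infinity>"
    using good by eventually_elim (simp add: l_def y_def)
  with upper lower show ?thesis
    unfolding tv_cutoff_def tv_def by blast
qed

end
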